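(* Let $\mathbb X$ be a reflexive real Banach space, $\mathbb Y$ a real Banach space, $C\subseteq\mathbb Y$ a closed convex cone with $\{0\}\neq C\neq\mathbb Y$, $K\subseteq\mathbb X$ a nonempty closed set and $f:\mathbb X\times\mathbb X\to\mathbb Y$. Let $\mathcal{SE}=\{\bar x\in K:\ f(\bar x,x)\in C\ \ \forall x\in K\}$, $\nu(x)=\sup_{z\in K}\mathrm{dist}(f(x,z),C)$, $\nu_{+K}(x)=\nu(x)+\mathrm{dist}(x,K)$ and $\overline K_x=\{z\in K:\mathrm{dist}(f(x,z),C)=\nu(x)\}$ for $x\in\mathbb X$. Suppose that: (i) $K$ is compact and convex and $\mathbb Y$ is reflexive; (ii) $f$ is continuous on $\mathbb X\times\mathbb X$; (iii) for every $z\in K$ the function $x\mapsto f(x,z)$ is $C$-concave on $\mathbb X$; (iv) for every $z\in K$ the function $x\mapsto f(x,z)$ is of class $\mathrm C^1(\mathbb X)$, with derivative $\mathrm Df(\cdot,z)(x)\in\mathcal L(\mathbb X,\mathbb Y)$ onto; (v) there exists $\gamma>0$ such that $$\left[\overline{\rm conv}^{\,*}\Big(\bigcup_{z\in\overline K_x}\mathrm Df(\cdot,z)(x)^*(B^*_C(x))\Big)+\widehat B^*_K(x)\right]\cap\gamma\mathbb B^*=\varnothing,\qquad\forall x\in\mathbb X\setminus\mathcal{SE}.$$ Then $\mathcal{SE}$ is nonempty, closed and convex, and $$\mathrm{dist}(x,\mathcal{SE})\le\frac{\nu_{+K}(x)}{\gamma},\qquad\forall x\in\mathbb X.$$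
   Context: $\mathbb B^*,\mathbb S^*$ denote the closed unit ball and unit sphere of the relevant dual space. $\mathcal L(\mathbb X,\mathbb Y)$ is the space of bounded linear operators; $\Lambda^*\in\mathcal L(\mathbb Y^*,\mathbb X^* )$ is the adjoint of $\Lambda$. $\overline{\rm conv}^{\,*}S$ is the weak$^*$-closed convex hull of $S\subseteq\mathbb X^*$. $\mathrm{dist}(x,S)=\inf_{s\in S}\|x-s\|$, with $\mathrm{dist}(x,\varnothing)=+\infty$. The order on $\mathbb Y$ is $y_1\le_C y_2\iff y_2-y_1\in C$. A mapping $g:\mathbb X\to\mathbb Y$ is $C$-concave on $\mathbb X$ if $tg(x_1)+(1-t)g(x_2)\le_C g(tx_1+(1-t)x_2)$ for all $x_1,x_2\in\mathbb X$, $t\in[0,1]$. $C^{\ominus}=\{y^*\in\mathbb Y^*:\langle y^*,y\rangle\le0\ \forall y\in C\}$. Define $B^*_C(x)=C^{\ominus}\cap\mathbb B^*$ if $\nu(x)=0$ and $B^*_C(x)=C^{\ominus}\cap\mathbb S^*$ if $\nu(x)>0$. For $K$ closed convex, let $\Pi(x;K)=\{w\in K:\|x-w\|=\mathrm{dist}(x,K)\}$ and $\mathrm N(w;K)=\{x^*\in\mathbb X^*:\langle x^*,y-w\rangle\le0\ \forall y\in K\}$. Define $\widehat B^*_K(x)=\mathrm N(x;K)\cap\mathbb B^*$ if $x\in K$, and $\widehat B^*_K(x)=\bigcap_{w\in\Pi(x;K)}\mathrm N(w;K)\cap\mathbb S^*$ if $x\notin K$. *)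

theory Defs
  imports "HOL-Analysis.Analysis"
begin

section \<open>Duality\<close>

type_synonym 'a dual = "'a \<Rightarrow>\<^sub>L real"

definition reflexive :: "'a::real_normed_vector itself \<Rightarrow> bool" where
  "reflexive _ \<longleftrightarrow>
     (\<forall>\<phi> :: 'a dual dual. \<exists>x::'a. \<forall>u. blinfun_apply \<phi> u = blinfun_apply u x)"

definition adjoint_op ::
    "('a::real_normed_vector \<Rightarrow>\<^sub>L 'b::real_normed_vector) \<Rightarrow> 'b dual \<Rightarrow> 'a dual" where
  "adjoint_op L v = v o\<^sub>L L"

text \<open>On bounded functionals the strong operator topology is the topology of pointwise
  convergence, that is, the weak-star topology.\<close>

definition weak_star_closed_conv :: "'a::real_normed_vector dual set \<Rightarrow> 'a dual set" where
  "weak_star_closed_conv S = strong_operator_topology closure_of (convex hull S)"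

section \<open>Distance and projection\<close>

text \<open>The distance is extended-real-valued so that the distance to the empty set is \<open>\<infinity>\<close>;
  the library's \<open>infdist\<close> is \<open>0\<close> there.\<close>

definition ext_dist :: "'a::metric_space \<Rightarrow> 'a set \<Rightarrow> ereal" where
  "ext_dist x S = (INF s\<in>S. ereal (dist x s))"

definition metric_proj :: "'a::metric_space \<Rightarrow> 'a set \<Rightarrow> 'a set" where
  "metric_proj x K = {w \<in> K. ereal (dist x w) = ext_dist x K}"

section \<open>Cones\<close>

definition cone_le :: "'b::real_vector set \<Rightarrow> 'b \<Rightarrow> 'b \<Rightarrow> bool" where
  "cone_le C y1 y2 \<longleftrightarrow> y2 - y1 \<in> C"

definition cone_concave :: "'b::real_vector set \<Rightarrow> ('a::real_vector \<Rightarrow> 'b) \<Rightarrow> bool" where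
  "cone_concave C g \<longleftrightarrow>
     (\<forall>x1 x2. \<forall>t\<in>{0..1}.
        cone_le C (t *\<^sub>R g x1 + (1 - t) *\<^sub>R g x2) (g (t *\<^sub>R x1 + (1 - t) *\<^sub>R x2)))"

definition neg_dual_cone :: "'b::real_normed_vector set \<Rightarrow> 'b dual set" where
  "neg_dual_cone C = {v. \<forall>y\<in>C. blinfun_apply v y \<le> 0}"

definition normal_cone :: "'a::real_normed_vector \<Rightarrow> 'a set \<Rightarrow> 'a dual set" where
  "normal_cone w K = {u. \<forall>y\<in>K. blinfun_apply u (y - w) \<le> 0}"

section \<open>Strong vector equilibria and their merit functions\<close>

definition strong_equilibria ::
    "('a \<Rightarrow> 'a \<Rightarrow> 'b) \<Rightarrow> 'a set \<Rightarrow> 'b set \<Rightarrow> 'a set" where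
  "strong_equilibria f K C = {x \<in> K. \<forall>z\<in>K. f x z \<in> C}"

definition merit ::
    "('a \<Rightarrow> 'a \<Rightarrow> 'b::metric_space) \<Rightarrow> 'a set \<Rightarrow> 'b set \<Rightarrow> 'a \<Rightarrow> ereal" where
  "merit f K C x = (SUP z\<in>K. ext_dist (f x z) C)"

definition merit_plus ::
    "('a::metric_space \<Rightarrow> 'a \<Rightarrow> 'b::metric_space) \<Rightarrow> 'a set \<Rightarrow> 'b set \<Rightarrow> 'a \<Rightarrow> ereal" where
  "merit_plus f K C x = merit f K C x + ext_dist x K"

definition active_set ::
    "('a \<Rightarrow> 'a \<Rightarrow> 'b::metric_space) \<Rightarrow> 'a set \<Rightarrow> 'b set \<Rightarrow> 'a \<Rightarrow> 'a set" where
  "active_set f K C x = {z \<in> K. ext_dist (f x z) C = merit f K C x}"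

text \<open>For nonempty \<open>K\<close> the function \<open>merit f K C\<close> is nonnegative, so the second branch
  is the case of a positive value.\<close>

definition cone_multipliers ::
    "('a \<Rightarrow> 'a \<Rightarrow> 'b::real_normed_vector) \<Rightarrow> 'a set \<Rightarrow> 'b set \<Rightarrow> 'a \<Rightarrow> 'b dual set" where
  "cone_multipliers f K C x =
     (if merit f K C x = 0 then neg_dual_cone C \<inter> cball 0 1
      else neg_dual_cone C \<inter> sphere 0 1)"

definition set_multipliers :: "'a::real_normed_vector set \<Rightarrow> 'a \<Rightarrow> 'a dual set" where
  "set_multipliers K x =
     (if x \<in> K then normal_cone x K \<inter> cball 0 1
      else (\<Inter>w\<in>metric_proj x K. normal_cone w K) \<inter> sphere 0 1)"

end

theory Submission
  imports Defs
begin

text \<open>Put \<open>\<phi> = \<nu> + dist(\<cdot>, K)\<close>, a nonnegative lower semicontinuous convex function.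
  Ekeland's principle, started at \<open>x\<close>, gives a point \<open>z\<close> with \<open>\<gamma> \<parallel>x - z\<parallel> \<le> \<phi>(x)\<close> at which
  \<open>\<phi> + \<gamma> \<parallel>\<cdot> - z\<parallel>\<close> is minimal. By the Hahn-Banach sum rule there are subgradients \<open>a\<close> of \<open>\<nu>\<close>
  and \<open>b\<close> of \<open>dist(\<cdot>, K)\<close> at \<open>z\<close> with \<open>\<parallel>a + b\<parallel> \<le> \<gamma>\<close>. Compactness of \<open>K\<close> and convexity
  bound \<open>a\<close> by the support function of the multiplier set of the active indices, so \<open>a\<close> lies in its
  weak-star closed convex hull, and \<open>b\<close> is a multiplier of \<open>K\<close>. The slope condition therefore
  forces \<open>z\<close> to be a strong equilibrium.\<close>

section \<open>Hahn-Banach theorems\<close>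

text \<open>Scaling is demanded only as an inequality, which passes easily to pointwise infima;
  equality for nonnegative factors follows by using the factors \<open>c\<close> and
  \<open>1/c\<close>.\<close>

definition sublinear :: "('a::real_vector \<Rightarrow> real) \<Rightarrow> bool" where
  "sublinear q \<longleftrightarrow> (\<forall>x y. q (x + y) \<le> q x + q y) \<and> (\<forall>c x. 0 < c \<longrightarrow> q (c *\<^sub>R x) \<le> c * q x)"

lemma sublinear_add: "sublinear q \<Longrightarrow> q (x + y) \<le> q x + q y"
  by (simp add: sublinear_def)

lemma sublinear_zero: "sublinear q \<Longrightarrow> q 0 = 0"
proof -
  assume q: "sublinear q"
  have "q 0 \<le> q 0 + q 0" using sublinear_add[OF q, of 0 0] by simp
  moreover have "q ((1/2) *\<^sub>R 0) \<le> 1/2 * q 0" using q unfolding sublinear_def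
    by (metis half_gt_zero_iff zero_less_one)
  ultimately show ?thesis by simp
qed

lemma sublinear_scale:
  assumes q: "sublinear q" and c: "0 \<le> c"
  shows "q (c *\<^sub>R x) = c * q x"
proof (cases "c = 0")
  case True
  then show ?thesis by (simp add: sublinear_zero[OF q])
next
  case False
  then have "c > 0" using c by simp
  then have "q (c *\<^sub>R x) \<le> c * q x" and "q ((1/c) *\<^sub>R (c *\<^sub>R x)) \<le> (1/c) * q (c *\<^sub>R x)"
    using q by (auto simp only: sublinear_def divide_pos_pos zero_less_one)
  then show ?thesis using \<open>c > 0\<close> by (simp add: field_simps)
qed

lemma sublinear_minus: "sublinear q \<Longrightarrow> - q (- x) \<le> q x"
  using sublinear_add[of q x "- x"] sublinear_zero[of q] by simp

text \<open>A minimal sublinear functional below \<open>p\<close> is linear.\<close>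

theorem hahn_banach_sublinear:
  fixes p :: "'a::real_vector \<Rightarrow> real"
  assumes p: "sublinear p"
  obtains l where "linear l" "\<And>x. l x \<le> p x"
proof -
  let ?A = "{q. sublinear q \<and> (\<forall>x. q x \<le> p x)}"
  let ?P = "\<lambda>q r :: 'a \<Rightarrow> real. \<forall>x. r x \<le> q x"
  \<comment> \<open>Zorn's lemma for the reversed pointwise order, so that a maximal element is a
    minimal sublinear minorant of \<open>p\<close>.\<close>
  have "\<exists>m \<in> ?A. \<forall>a \<in> ?A. ?P m a \<longrightarrow> a = m"
  proof (rule predicate_Zorn)
    show "partial_order_on ?A (relation_of ?P ?A)"
      by (rule partial_order_on_relation_ofI) (auto intro: order_trans intro!: ext antisym)
    fix C assume C: "C \<in> Chains (relation_of ?P ?A)"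
    show "\<exists>u \<in> ?A. \<forall>a \<in> C. ?P a u"
    proof (cases "C = {}")
      case True
      then show ?thesis using p by auto
    next
      case False
      have CA: "sublinear q" "q x \<le> p x" if "q \<in> C" for q x
        using C that unfolding Chains_def relation_of_def by auto
      have tot: "(\<forall>x. q x \<le> r x) \<or> (\<forall>x. r x \<le> q x)" if "q \<in> C" "r \<in> C" for q r
        using C that unfolding Chains_def relation_of_def by auto
      define u where "u = (\<lambda>x. INF q\<in>C. q x)"
      have bdd: "bdd_below ((\<lambda>q. q x) ` C)" for x
      proof (rule bdd_belowI2)
        fix q assume "q \<in> C"
        then show "- p (- x) \<le> q x"
          using CA(1)[of q] CA(2)[of q "- x"] sublinear_minus[of q x] by force
      qed
      have u_le: "u x \<le> q x" if "q \<in> C" for q x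
        unfolding u_def by (rule cINF_lower[OF bdd that])
      have le_u: "c \<le> u x" if "\<And>q. q \<in> C \<Longrightarrow> c \<le> q x" for c x
        unfolding u_def by (rule cINF_greatest[OF False that])
      have add: "u (x + y) \<le> u x + u y" for x y
      proof -
        \<comment> \<open>Two members of a chain are comparable, so the smaller one serves for both
          summands. This makes the pointwise infimum subadditive.\<close>
        have qr: "u (x + y) \<le> q x + r y" if q: "q \<in> C" and r: "r \<in> C" for q r
        proof -
          obtain m where m: "m \<in> C" "\<forall>x. m x \<le> q x" "\<forall>x. m x \<le> r x"
            using tot[OF q r] q r by (meson order_refl)
          have "u (x + y) \<le> m x + m y"
            using u_le[OF m(1), of "x + y"] sublinear_add[OF CA(1)[OF m(1)], of x y] by linarith
          then show ?thesis using m(2)[rule_format, of x] m(3)[rule_format, of y] by linarith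
        qed
        have "u (x + y) - r y \<le> u x" if "r \<in> C" for r
          by (rule le_u) (use qr[OF _ that] in \<open>simp add: algebra_simps\<close>)
        then have "u (x + y) - u x \<le> u y"
          by (intro le_u) (simp add: algebra_simps)
        then show ?thesis by simp
      qed
      have scale: "u (c *\<^sub>R x) \<le> c * u x" if "0 < c" for c x
      proof -
        have "u (c *\<^sub>R x) / c \<le> u x"
        proof (rule le_u)
          fix q assume q: "q \<in> C"
          have "u (c *\<^sub>R x) \<le> c * q x"
            using u_le[OF q, of "c *\<^sub>R x"] sublinear_scale[OF CA(1)[OF q]] that by simp
          then show "u (c *\<^sub>R x) / c \<le> q x" using that by (simp add: field_simps)
        qed
        then show ?thesis using that by (simp add: field_simps)
      qed
      obtain q where "q \<in> C" using False by blast
      then have "u x \<le> p x" for x using u_le CA(2) order_trans by blast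
      then have "u \<in> ?A" using add scale by (auto simp: sublinear_def)
      then show ?thesis using u_le by blast
    qed
  qed
  then obtain m where m: "sublinear m" "\<And>x. m x \<le> p x"
    and min: "\<And>a. sublinear a \<Longrightarrow> \<forall>x. a x \<le> p x \<Longrightarrow> \<forall>x. a x \<le> m x \<Longrightarrow> a = m"
    by auto
  have odd: "m (- y) \<le> - m y" for y
  proof -
    \<comment> \<open>\<open>q\<close> is again sublinear and lies below \<open>m\<close> (take
      \<open>t = 0\<close>), so minimality forces \<open>q = m\<close>. Taking \<open>t = 1\<close>
      at the point \<open>- y\<close> then gives oddness of \<open>m\<close>.\<close>
    define q where "q = (\<lambda>x. INF t\<in>{0..}. m (x + t *\<^sub>R y) - t * m y)"
    have bdd: "bdd_below ((\<lambda>t. m (x + t *\<^sub>R y) - t * m y) ` {0..})" for x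
    proof (rule bdd_belowI2)
      fix t :: real assume "t \<in> {0..}"
      then show "- m (- x) \<le> m (x + t *\<^sub>R y) - t * m y"
        using sublinear_add[OF m(1), of "x + t *\<^sub>R y" "- x"] sublinear_scale[OF m(1), of t y] by simp
    qed
    have q_le: "q x \<le> m (x + t *\<^sub>R y) - t * m y" if "0 \<le> t" for x t
      unfolding q_def by (rule cINF_lower[OF bdd]) (use that in simp)
    have le_q: "c \<le> q x" if "\<And>t. 0 \<le> t \<Longrightarrow> c \<le> m (x + t *\<^sub>R y) - t * m y" for c x
      unfolding q_def by (rule cINF_greatest) (use that in auto)
    have add: "q (x + z) \<le> q x + q z" for x z
    proof -
      have st: "q (x + z) \<le> (m (x + s *\<^sub>R y) - s * m y) + (m (z + t *\<^sub>R y) - t * m y)"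
        if "0 \<le> s" "0 \<le> t" for s t
        using q_le[of "s + t" "x + z"] sublinear_add[OF m(1), of "x + s *\<^sub>R y" "z + t *\<^sub>R y"] that
        by (simp add: algebra_simps)
      have "q (x + z) - (m (z + t *\<^sub>R y) - t * m y) \<le> q x" if "0 \<le> t" for t
        by (rule le_q) (use st[OF _ that] in \<open>simp add: algebra_simps\<close>)
      then have "q (x + z) - q x \<le> q z"
        by (intro le_q) (simp add: algebra_simps)
      then show ?thesis by simp
    qed
    have scale: "q (c *\<^sub>R x) \<le> c * q x" if "0 < c" for c x
    proof -
      have "q (c *\<^sub>R x) / c \<le> q x"
      proof (rule le_q)
        fix t :: real assume t: "0 \<le> t"
        have "q (c *\<^sub>R x) \<le> m (c *\<^sub>R (x + t *\<^sub>R y)) - c * t * m y"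
          using q_le[of "c * t" "c *\<^sub>R x"] t that by (simp add: scaleR_add_right)
        also have "\<dots> = c * (m (x + t *\<^sub>R y) - t * m y)"
          using sublinear_scale[OF m(1), of c "x + t *\<^sub>R y"] that by (simp add: right_diff_distrib)
        finally show "q (c *\<^sub>R x) / c \<le> m (x + t *\<^sub>R y) - t * m y"
          using that by (simp add: field_simps)
      qed
      then show ?thesis using that by (simp add: field_simps)
    qed
    have qm: "q x \<le> m x" for x using q_le[of 0 x] by simp
    have "q = m"
    proof (rule min)
      show "sublinear q" using add scale by (auto simp: sublinear_def)
      show "\<forall>x. q x \<le> p x" using qm m(2) order_trans by blast
    qed (use qm in blast)
    then show ?thesis using q_le[of 1 "- y"] sublinear_zero[OF m(1)] by simp
  qed
  have neg: "m (- y) = - m y" for y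
    using odd[of y] sublinear_minus[OF m(1), of y] by linarith
  have "linear m"
  proof (rule linearI)
    fix x y show "m (x + y) = m x + m y"
      using sublinear_add[OF m(1), of x y] sublinear_add[OF m(1), of "x + y" "- y"] neg[of y] by simp
    fix c :: real show "m (c *\<^sub>R x) = c *\<^sub>R m x"
    proof (cases "0 \<le> c")
      case True then show ?thesis by (simp add: sublinear_scale[OF m(1)])
    next
      case False
      then have "m ((- c) *\<^sub>R x) = - c * m x" by (simp only: sublinear_scale[OF m(1)])
      then show ?thesis using neg[of "c *\<^sub>R x"] by simp
    qed
  qed
  then show thesis using m(2) that by blast
qed

text \<open>The infimum of \<open>p (t *\<^sub>R x) / t\<close> over positive \<open>t\<close> is a
  sublinear function below \<open>p\<close>; the sign of \<open>p 0\<close> keeps it finite.\<close>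

corollary hahn_banach_convex:
  fixes p :: "'a::real_vector \<Rightarrow> real"
  assumes p: "convex_on UNIV p" and p0: "0 \<le> p 0"
  obtains l where "linear l" "\<And>x. l x \<le> p x"
proof -
  define q where "q = (\<lambda>x. INF t\<in>{0<..}. p (t *\<^sub>R x) / t)"
  have cvx: "p (u *\<^sub>R x + v *\<^sub>R y) \<le> u * p x + v * p y" if "0 \<le> u" "0 \<le> v" "u + v = 1" for u v x y
    using p that by (auto simp: convex_on_def)
  have bdd: "bdd_below ((\<lambda>t. p (t *\<^sub>R x) / t) ` {0<..})" for x
  proof (rule bdd_belowI2)
    fix t :: real assume "t \<in> {0<..}"
    then have t: "t > 0" by simp
    \<comment> \<open>The weights make this combination of \<open>t *\<^sub>R x\<close> and
      \<open>- x\<close> equal to \<open>0\<close>, where \<open>p\<close> is nonnegative.\<close>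
    have "p ((1/(1+t)) *\<^sub>R (t *\<^sub>R x) + (t/(1+t)) *\<^sub>R (- x)) \<le> 1/(1+t) * p (t *\<^sub>R x) + t/(1+t) * p (- x)"
      by (rule cvx) (use t in \<open>auto simp: field_simps\<close>)
    then have "0 \<le> (p (t *\<^sub>R x) + t * p (- x)) / (1+t)"
      using p0 by (simp add: add_divide_distrib)
    then show "- p (- x) \<le> p (t *\<^sub>R x) / t" using t by (simp add: field_simps zero_le_divide_iff)
  qed
  have q_le: "q x \<le> p (t *\<^sub>R x) / t" if "0 < t" for x t
    unfolding q_def by (rule cINF_lower[OF bdd]) (use that in simp)
  have le_q: "c \<le> q x" if "\<And>t. 0 < t \<Longrightarrow> c \<le> p (t *\<^sub>R x) / t" for c x
    unfolding q_def by (rule cINF_greatest) (use that in auto)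
  have add: "q (x + z) \<le> q x + q z" for x z
  proof -
    have st: "q (x + z) \<le> p (s *\<^sub>R x) / s + p (t *\<^sub>R z) / t" if "0 < s" "0 < t" for s t
    proof -
      \<comment> \<open>With this value, \<open>?r *\<^sub>R (x + z)\<close> is the convex
        combination of \<open>s *\<^sub>R x\<close> and \<open>t *\<^sub>R z\<close> with weights
        \<open>t/(s+t)\<close> and \<open>s/(s+t)\<close>.\<close>
      let ?r = "s * t / (s + t)"
      have r: "?r > 0" using that by simp
      have st: "s + t \<noteq> 0" using that by simp
      have "p (?r *\<^sub>R (x + z)) = p ((t/(s+t)) *\<^sub>R (s *\<^sub>R x) + (s/(s+t)) *\<^sub>R (t *\<^sub>R z))"
        by (simp add: scaleR_add_right mult.commute)
      also have "\<dots> \<le> t/(s+t) * p (s *\<^sub>R x) + s/(s+t) * p (t *\<^sub>R z)"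
        by (rule cvx) (use that st in \<open>auto simp flip: add_divide_distrib simp: add.commute\<close>)
      also have "\<dots> = ?r * (p (s *\<^sub>R x) / s + p (t *\<^sub>R z) / t)"
      proof -
        have "s * t * (p (s *\<^sub>R x) / s + p (t *\<^sub>R z) / t) = t * p (s *\<^sub>R x) + s * p (t *\<^sub>R z)"
          using that by (simp add: field_simps)
        then show ?thesis by (simp add: add_divide_distrib)
      qed
      finally have "p (?r *\<^sub>R (x + z)) / ?r \<le> p (s *\<^sub>R x) / s + p (t *\<^sub>R z) / t"
        using r by (simp only: pos_divide_le_eq mult.commute)
      then show ?thesis using q_le[OF r, of "x + z"] by linarith
    qed
    have "q (x + z) - p (t *\<^sub>R z) / t \<le> q x" if "0 < t" for t
      by (rule le_q) (use st[OF _ that] in \<open>simp add: algebra_simps\<close>)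
    then have "q (x + z) - q x \<le> q z"
      by (intro le_q) (simp add: algebra_simps)
    then show ?thesis by simp
  qed
  have scale: "q (c *\<^sub>R x) \<le> c * q x" if "0 < c" for c x
  proof -
    have "q (c *\<^sub>R x) / c \<le> q x"
    proof (rule le_q)
      fix t :: real assume t: "0 < t"
      show "q (c *\<^sub>R x) / c \<le> p (t *\<^sub>R x) / t"
        using q_le[of "t / c" "c *\<^sub>R x"] t that by (simp add: field_simps)
    qed
    then show ?thesis using that by (simp add: field_simps)
  qed
  obtain l where "linear l" "\<And>x. l x \<le> q x"
    using hahn_banach_sublinear[of q] add scale by (auto simp: sublinear_def)
  then show thesis using that q_le[of 1] by (metis div_by_1 order_trans scaleR_one zero_less_one)
qed

text \<open>This is the algebraic core of the subgradient sum rule. The infimal convolution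
  \<open>r\<close> of \<open>p\<close> with the reflection of \<open>q\<close> is convex with
  \<open>r 0\<close> nonnegative; a linear minorant of \<open>r\<close> lies below \<open>p\<close>
  (take \<open>k = 0\<close>) and below the reflected \<open>q\<close> (take
  \<open>k = - h\<close>).\<close>

corollary convex_sandwich:
  fixes p q :: "'a::real_vector \<Rightarrow> real"
  assumes p: "convex_on UNIV p" "p 0 = 0" and q: "convex_on UNIV q" "q 0 = 0"
    and pq: "\<And>x. 0 \<le> p x + q x"
  obtains l where "linear l" "\<And>x. l x \<le> p x" "\<And>x. - l x \<le> q x"
proof -
  define r where "r = (\<lambda>h. INF k. p (h + k) + q k)"
  have pc: "p (u *\<^sub>R x + v *\<^sub>R y) \<le> u * p x + v * p y"
    and qc: "q (u *\<^sub>R x + v *\<^sub>R y) \<le> u * q x + v * q y"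
    if "0 \<le> u" "0 \<le> v" "u + v = 1" for u v x y
    using p q that by (auto simp: convex_on_def)
  have bdd: "bdd_below (range (\<lambda>k. p (h + k) + q k))" for h
  proof (rule bdd_belowI2)
    fix k :: 'a
    \<comment> \<open>The point \<open>(1/2) *\<^sub>R k\<close> is the midpoint of \<open>k\<close>
      and \<open>0\<close> and also of \<open>h + k\<close> and \<open>- h\<close>; applying
      \<open>pq\<close> there bounds the infimum from below.\<close>
    have "q ((1/2) *\<^sub>R k + (1/2) *\<^sub>R 0) \<le> q k / 2" "p ((1/2) *\<^sub>R (h + k) + (1/2) *\<^sub>R (- h)) \<le> p (h + k) / 2 + p (- h) / 2"
      using qc[of "1/2" "1/2" k 0] pc[of "1/2" "1/2" "h + k" "- h"] q(2) by auto
    then show "- p (- h) \<le> p (h + k) + q k"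
      using pq[of "(1/2) *\<^sub>R k"] by (simp add: scaleR_add_right)
  qed
  have r_le: "r h \<le> p (h + k) + q k" for h k
    unfolding r_def by (rule cINF_lower[OF bdd]) simp
  have le_r: "c \<le> r h" if "\<And>k. c \<le> p (h + k) + q k" for c h
    unfolding r_def by (rule cINF_greatest) (use that in auto)
  have "convex_on UNIV r"
    unfolding convex_on_def
  proof (intro conjI ballI allI impI)
    fix x y :: 'a and u v :: real assume uv: "0 \<le> u" "0 \<le> v" "u + v = 1"
    show "r (u *\<^sub>R x + v *\<^sub>R y) \<le> u * r x + v * r y"
    proof (rule field_le_epsilon)
      fix e :: real assume e: "0 < e"
      have near: "\<exists>k. p (z + k) + q k < r z + e" for z
        using le_r[where c = "r z + e" and h = z] e by (auto simp: not_less[symmetric])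
      obtain k where k: "p (x + k) + q k < r x + e" using near by blast
      obtain j where j: "p (y + j) + q j < r y + e" using near by blast
      have "r (u *\<^sub>R x + v *\<^sub>R y) \<le> p (u *\<^sub>R (x + k) + v *\<^sub>R (y + j)) + q (u *\<^sub>R k + v *\<^sub>R j)"
        using r_le[of "u *\<^sub>R x + v *\<^sub>R y" "u *\<^sub>R k + v *\<^sub>R j"] by (simp add: algebra_simps)
      also have "\<dots> \<le> u * (p (x + k) + q k) + v * (p (y + j) + q j)"
        using pc[OF uv, of "x + k" "y + j"] qc[OF uv, of k j] by (simp add: algebra_simps)
      also have "\<dots> \<le> u * (r x + e) + v * (r y + e)"
        by (rule add_mono; rule mult_left_mono) (use k j uv in auto)
      also have "\<dots> = u * r x + v * r y + e"
        using arg_cong[OF uv(3), of "\<lambda>w. w * e"] by (simp add: algebra_simps)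
      finally show "r (u *\<^sub>R x + v *\<^sub>R y) \<le> u * r x + v * r y + e" .
    qed
  qed simp
  moreover have "0 \<le> r 0" by (rule le_r) (use pq in simp)
  ultimately obtain l where l: "linear l" "\<And>x. l x \<le> r x" by (rule hahn_banach_convex) auto
  show thesis
  proof
    show "linear l" by fact
    show "l x \<le> p x" for x using l(2)[of x] r_le[of x 0] q by simp
    show "- l x \<le> q x" for x using l(2)[of "- x"] r_le[of "- x" x] p linear_neg[OF l(1), of x] by simp
  qed
qed

lemma linear_bounded_above_blinfun:
  fixes l :: "'a::real_normed_vector \<Rightarrow> real"
  assumes l: "linear l" and K: "0 \<le> K" and le: "\<And>x. l x \<le> K * norm x"
  obtains v :: "'a dual" where "blinfun_apply v = l" "norm v \<le> K"
proof -
  have ab: "norm (l x) \<le> K * norm x" for x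
    using le[of x] le[of "- x"] linear_neg[OF l, of x] by simp
  then have "bounded_linear l"
    using l by (intro bounded_linear_intro[of l K]) (auto simp: linear_add linear_scale mult.commute)
  then have "blinfun_apply (Blinfun l) = l" by (rule bounded_linear_Blinfun_apply)
  moreover have "norm (Blinfun l) \<le> K"
    using ab K calculation by (intro norm_blinfun_bound) auto
  ultimately show thesis using that by blast
qed

section \<open>Subgradients of the distance function\<close>

lemma infdist_approx:
  assumes "S \<noteq> {}" "0 < e"
  obtains s where "s \<in> S" "dist x s < infdist x S + e"
proof -
  have "(INF s\<in>S. dist x s) < infdist x S + e" using assms by (simp add: infdist_notempty)
  then show thesis using that assms(1) by (auto simp: cINF_less_iff bdd_below_image_dist)
qed

lemma convex_on_infdist:
  fixes C :: "'a::real_normed_vector set"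
  assumes C: "convex C"
  shows "convex_on UNIV (\<lambda>x. infdist x C)"
proof (cases "C = {}")
  \<comment> \<open>\<open>infdist\<close> to the empty set is constantly \<open>0\<close>.\<close>
  case True then show ?thesis by (simp add: infdist_def convex_on_def)
next
  case False
  show ?thesis unfolding convex_on_def
  proof (intro conjI ballI allI impI)
    fix x y :: 'a and u v :: real assume uv: "0 \<le> u" "0 \<le> v" "u + v = 1"
    show "infdist (u *\<^sub>R x + v *\<^sub>R y) C \<le> u * infdist x C + v * infdist y C"
    proof (rule field_le_epsilon)
      fix e :: real assume e: "0 < e"
      obtain s where s: "s \<in> C" "dist x s < infdist x C + e" using infdist_approx[OF False e] by blast
      obtain t where t: "t \<in> C" "dist y t < infdist y C + e" using infdist_approx[OF False e] by blast
      have "u *\<^sub>R s + v *\<^sub>R t \<in> C" using C s t uv by (simp add: convexD)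
      then have "infdist (u *\<^sub>R x + v *\<^sub>R y) C \<le> dist (u *\<^sub>R x + v *\<^sub>R y) (u *\<^sub>R s + v *\<^sub>R t)"
        by (rule infdist_le)
      also have "\<dots> = norm (u *\<^sub>R (x - s) + v *\<^sub>R (y - t))"
        by (simp add: dist_norm algebra_simps)
      also have "\<dots> \<le> u * dist x s + v * dist y t"
        using uv norm_triangle_ineq[of "u *\<^sub>R (x - s)" "v *\<^sub>R (y - t)"] by (simp add: dist_norm)
      also have "\<dots> \<le> u * (infdist x C + e) + v * (infdist y C + e)"
        using s t uv by (intro add_mono mult_left_mono) auto
      also have "\<dots> = u * infdist x C + v * infdist y C + e"
        using arg_cong[OF uv(3), of "\<lambda>w. w * e"] by (simp add: algebra_simps)
      finally show "infdist (u *\<^sub>R x + v *\<^sub>R y) C \<le> u * infdist x C + v * infdist y C + e" .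
    qed
  qed simp
qed

lemma convex_on_shift:
  fixes g :: "'a::real_vector \<Rightarrow> real"
  assumes "convex_on UNIV g"
  shows "convex_on UNIV (\<lambda>h. g (x + h) - c)"
  unfolding convex_on_def
proof (intro conjI ballI allI impI)
  fix h k and u v :: real assume uv: "0 \<le> u" "0 \<le> v" "u + v = 1"
  have "x + (u *\<^sub>R h + v *\<^sub>R k) = u *\<^sub>R (x + h) + v *\<^sub>R (x + k)"
    using uv by (simp add: algebra_simps flip: scaleR_add_left)
  then have "g (x + (u *\<^sub>R h + v *\<^sub>R k)) \<le> u * g (x + h) + v * g (x + k)"
    using assms uv by (simp add: convex_on_def)
  moreover have "u * c + v * c = c" using uv by (metis distrib_right mult_1)
  ultimately show "g (x + (u *\<^sub>R h + v *\<^sub>R k)) - c \<le> u * (g (x + h) - c) + v * (g (x + k) - c)"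
    by (simp add: right_diff_distrib)
qed simp

text \<open>A linear minorant of the increments of the distance exists by convexity; since the
  distance is 1-Lipschitz, this minorant is bounded with norm at most \<open>1\<close>.\<close>

lemma infdist_subgradient_exists:
  fixes C :: "'a::real_normed_vector set"
  assumes C: "convex C"
  obtains v :: "'a dual" where "norm v \<le> 1" "\<And>w. blinfun_apply v (w - y) \<le> infdist w C - infdist y C"
proof -
  have "convex_on UNIV (\<lambda>h. infdist (y + h) C - infdist y C)"
    by (rule convex_on_shift[OF convex_on_infdist[OF C]])
  then obtain l where l: "linear l" "\<And>h. l h \<le> infdist (y + h) C - infdist y C"
    by (rule hahn_banach_convex) auto
  have "l h \<le> 1 * norm h" for h
    using l(2)[of h] infdist_triangle[of "y + h" C y] by (simp add: dist_norm)
  then obtain v :: "'a dual" where v: "blinfun_apply v = l" "norm v \<le> 1"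
    using linear_bounded_above_blinfun[OF l(1), of 1] by auto
  show thesis
  proof (rule that[of v])
    fix w show "blinfun_apply v (w - y) \<le> infdist w C - infdist y C" using l(2)[of "w - y"] v by simp
  qed fact
qed

lemma infdist_subgradient_norm_le:
  fixes v :: "'a::real_normed_vector dual"
  assumes sub: "\<And>w. blinfun_apply v (w - y) \<le> infdist w C - infdist y C"
  shows "norm v \<le> 1"
proof (rule norm_blinfun_bound)
  fix h
  have le: "blinfun_apply v k \<le> norm k" for k
    using sub[of "y + k"] infdist_triangle[of "y + k" C y] by (simp add: dist_norm)
  show "norm (blinfun_apply v h) \<le> 1 * norm h"
    using le[of h] le[of "- h"] by (simp add: blinfun.minus_right)
qed simp

text \<open>Towards a nearly closest point of \<open>C\<close> the distance falls by its full value
  over a step of almost that length, so the slope cannot be smaller than one.\<close>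

lemma infdist_subgradient_norm:
  fixes v :: "'a::real_normed_vector dual"
  assumes C: "closed C" "C \<noteq> {}" "y \<notin> C"
    and sub: "\<And>w. blinfun_apply v (w - y) \<le> infdist w C - infdist y C"
  shows "norm v = 1"
proof (rule antisym[OF infdist_subgradient_norm_le[OF sub]], rule ccontr)
  assume "\<not> 1 \<le> norm v"
  then have lt: "norm v < 1" by simp
  have d: "infdist y C > 0" using infdist_pos_not_in_closed C by blast
  \<comment> \<open>This tolerance turns the estimate at a nearly closest point into
    \<open>e \<le> norm v * e\<close>, impossible for \<open>norm v < 1\<close>.\<close>
  define e where "e = (1 - norm v) * infdist y C"
  have "e > 0" using lt d by (simp add: e_def)
  then obtain s where s: "s \<in> C" "dist y s < infdist y C + e" using infdist_approx[OF C(2)] by blast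
  have "infdist y C \<le> - blinfun_apply v (s - y)" using sub[of s] s by simp
  also have "\<dots> \<le> norm v * dist y s"
    using norm_blinfun[of v "s - y"] by (simp add: dist_norm norm_minus_commute abs_le_iff)
  also have "\<dots> \<le> norm v * (infdist y C + e)" using s by (intro mult_left_mono) auto
  also have "\<dots> = norm v * infdist y C + norm v * e" by (simp add: algebra_simps)
  finally have "e \<le> norm v * e" by (simp add: e_def algebra_simps)
  then show False using lt \<open>e > 0\<close> by simp
qed

section \<open>Weak-star closed convex hulls\<close>

text \<open>The topology is pulled back from the product topology along
  \<open>blinfun_apply\<close>, and a basic open set of the product restricts only finitely many
  coordinates.\<close>

lemma in_weak_star_closureI:
  fixes a :: "'a::real_normed_vector dual"
  assumes "\<And>I e. finite I \<Longrightarrow> 0 < e \<Longrightarrow> \<exists>s\<in>S. \<forall>i\<in>I. \<bar>blinfun_apply s i - blinfun_apply a i\<bar> < e"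
  shows "a \<in> strong_operator_topology closure_of S"
  unfolding in_closure_of
proof (intro conjI allI impI)
  show "a \<in> topspace strong_operator_topology" by (simp add: strong_operator_topology_topspace)
  fix T assume T: "a \<in> T \<and> openin strong_operator_topology T"
  then obtain U where U: "open U" "T = blinfun_apply -` U"
    unfolding strong_operator_topology_def openin_pullback_topology by auto
  then have "openin (product_topology (\<lambda>i. euclidean) UNIV) U" by (simp add: open_fun_def)
  moreover have "blinfun_apply a \<in> U" using T U by auto
  ultimately obtain X where X: "blinfun_apply a \<in> Pi\<^sub>E UNIV X" "\<And>i. open (X i)"
      "finite {i. X i \<noteq> UNIV}" "Pi\<^sub>E UNIV X \<subseteq> U"
    using product_topology_open_contains_basis[of "\<lambda>i. euclidean" UNIV U "blinfun_apply a"] by auto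
  let ?I = "{i. X i \<noteq> UNIV}"
  have "\<forall>i. \<exists>e>0. ball (blinfun_apply a i) e \<subseteq> X i"
    using X(1,2) by (auto simp: PiE_iff open_contains_ball)
  then obtain d where d: "\<And>i. d i > 0" "\<And>i. ball (blinfun_apply a i) (d i) \<subseteq> X i" by metis
  \<comment> \<open>The inserted \<open>1\<close> keeps the minimum meaningful when no coordinate is
    restricted.\<close>
  define e where "e = Min (insert 1 (d ` ?I))"
  have "e > 0" "\<And>i. i \<in> ?I \<Longrightarrow> e \<le> d i" using X(3) d(1) by (auto simp: e_def)
  then obtain s where s: "s \<in> S" "\<forall>i\<in>?I. \<bar>blinfun_apply s i - blinfun_apply a i\<bar> < e"
    using assms[OF X(3)] by blast
  have "blinfun_apply s i \<in> X i" for i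
  proof (cases "i \<in> ?I")
    case True
    then have "blinfun_apply s i \<in> ball (blinfun_apply a i) (d i)"
      using s(2) \<open>\<And>i. i \<in> ?I \<Longrightarrow> e \<le> d i\<close> by (force simp: dist_real_def abs_minus_commute)
    then show ?thesis using d(2) by blast
  qed auto
  then have "blinfun_apply s \<in> U" using X(4) by (auto simp: PiE_iff)
  then show "\<exists>y. y \<in> S \<and> y \<in> T" using s(1) U by auto
qed

text \<open>A projection argument in the coordinates \<open>I\<close>. If the squared distance
  \<open>q\<close> from \<open>a\<close> to \<open>S\<close> had a positive infimum
  \<open>m\<close>, the support condition in the direction of the residual at a near-minimizer
  \<open>s\<close> would give some \<open>t\<close> in \<open>S\<close> such that moving from
  \<open>s\<close> towards \<open>t\<close> brings \<open>q\<close> below \<open>m\<close>.\<close>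

lemma convex_finite_approx:
  fixes a :: "'a::real_normed_vector dual"
  assumes S: "convex S" and supp: "\<And>h e. 0 < e \<Longrightarrow> \<exists>s\<in>S. blinfun_apply a h \<le> blinfun_apply s h + e"
    and bdd: "\<And>h. \<exists>M. \<forall>s\<in>S. \<bar>blinfun_apply s h\<bar> \<le> M"
    and I: "finite I" and e: "0 < e"
  shows "\<exists>s\<in>S. (\<Sum>i\<in>I. (blinfun_apply a i - blinfun_apply s i)\<^sup>2) < e"
proof (rule ccontr)
  define q where "q s = (\<Sum>i\<in>I. (blinfun_apply a i - blinfun_apply s i)\<^sup>2)" for s
  assume "\<not> ?thesis"
  then have qe: "e \<le> q s" if "s \<in> S" for s using that by (auto simp: q_def not_less)
  define m where "m = (INF s\<in>S. q s)"
  have ne: "S \<noteq> {}" using supp[of 1] by auto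
  have bb: "bdd_below (q ` S)" using qe by (rule bdd_belowI2)
  have "e \<le> m" unfolding m_def using ne qe by (rule cINF_greatest)
  then have m: "0 < m" using e by simp
  have mq: "m \<le> q s" if "s \<in> S" for s unfolding m_def by (rule cINF_lower[OF bb that])
  obtain M where M: "\<And>h s. s \<in> S \<Longrightarrow> \<bar>blinfun_apply s h\<bar> \<le> M h" using bdd by metis
  \<comment> \<open>\<open>R\<close> bounds squared distances within \<open>S\<close> over the
    coordinates \<open>I\<close>; the summand \<open>m\<close> ensures \<open>m \<le> R\<close> and
    hence \<open>R > 0\<close>.\<close>
  define R where "R = (\<Sum>i\<in>I. (2 * M i)\<^sup>2) + m"
  have R: "(\<Sum>i\<in>I. (blinfun_apply t i - blinfun_apply s i)\<^sup>2) \<le> R" if "s \<in> S" "t \<in> S" for s t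
  proof -
    have "(blinfun_apply t i - blinfun_apply s i)\<^sup>2 \<le> (2 * M i)\<^sup>2" for i
      using M[OF that(1), of i] M[OF that(2), of i]
      by (intro power2_le_iff_abs_le[THEN iffD2]) auto
    then have "(\<Sum>i\<in>I. (blinfun_apply t i - blinfun_apply s i)\<^sup>2) \<le> (\<Sum>i\<in>I. (2 * M i)\<^sup>2)"
      by (intro sum_mono)
    then show ?thesis using m by (simp add: R_def)
  qed
  have Rm: "m \<le> R" by (simp add: R_def sum_nonneg)
  \<comment> \<open>The step length is at most \<open>1\<close> and makes the quadratic term at most
    \<open>l * m / 2\<close>, whereas the linear term gains at least
    \<open>3 * l * m / 2\<close>.\<close>
  define l where "l = m / (2 * R)"
  have l: "0 < l" "l \<le> 1" "l * R = m / 2" using m Rm by (auto simp: l_def)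
  obtain s where s: "s \<in> S" "q s < m + l * m / 2"
  proof -
    have "(INF s\<in>S. q s) < m + l * m / 2" using m l by (simp add: m_def[symmetric])
    then show thesis using that bb ne by (auto simp: cINF_less_iff)
  qed
  define c where "c i = blinfun_apply a i - blinfun_apply s i" for i
  \<comment> \<open>Evaluating a functional at \<open>h\<close> is the inner product of its
    coordinates with the residual \<open>c\<close>.\<close>
  define h where "h = (\<Sum>i\<in>I. c i *\<^sub>R i)"
  have h: "blinfun_apply v h = (\<Sum>i\<in>I. c i * blinfun_apply v i)" for v :: "'a dual"
    by (simp add: h_def blinfun.sum_right blinfun.scaleR_right)
  obtain t where t: "t \<in> S" "blinfun_apply a h \<le> blinfun_apply t h + m / 4" using supp[of "m / 4" h] m by auto
  define d where "d i = blinfun_apply t i - blinfun_apply s i" for i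
  have qs: "q s = (\<Sum>i\<in>I. (c i)\<^sup>2)" by (simp add: q_def c_def)
  have "(\<Sum>i\<in>I. c i * d i) = blinfun_apply t h - blinfun_apply s h"
    by (simp add: h d_def right_diff_distrib sum_subtractf)
  also have "\<dots> \<ge> blinfun_apply a h - blinfun_apply s h - m / 4" using t by simp
  also have "blinfun_apply a h - blinfun_apply s h = q s"
    by (simp add: h qs c_def power2_eq_square flip: sum_subtractf right_diff_distrib)
  finally have cd: "3 * m / 4 \<le> (\<Sum>i\<in>I. c i * d i)" using mq[OF s(1)] by simp
  define w where "w = (1 - l) *\<^sub>R s + l *\<^sub>R t"
  have w: "w \<in> S" unfolding w_def using S s t l by (intro convexD) auto
  have "q w = (\<Sum>i\<in>I. (c i - l * d i)\<^sup>2)"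
    unfolding q_def w_def c_def d_def
    by (intro sum.cong refl arg_cong[where f = "\<lambda>r. r\<^sup>2"])
      (simp add: blinfun.add_left blinfun.scaleR_left left_diff_distrib right_diff_distrib)
  also have "\<dots> = (\<Sum>i\<in>I. (c i)\<^sup>2 + l * l * (d i)\<^sup>2 - 2 * l * (c i * d i))"
    by (rule sum.cong) (auto simp: power2_eq_square algebra_simps)
  also have "\<dots> = q s + l * l * (\<Sum>i\<in>I. (d i)\<^sup>2) - 2 * l * (\<Sum>i\<in>I. c i * d i)"
    by (simp add: qs sum.distrib sum_subtractf sum_distrib_left)
  also have "\<dots> < (m + l * m / 2) + l * (m / 2) - 2 * l * (3 * m / 4)"
  proof -
    have "l * (l * (\<Sum>i\<in>I. (d i)\<^sup>2)) \<le> l * (l * R)"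
      using R[OF s(1) t(1)] l by (intro mult_left_mono) (auto simp: d_def)
    moreover have "2 * l * (3 * m / 4) \<le> 2 * l * (\<Sum>i\<in>I. c i * d i)"
      using cd l by (intro mult_left_mono) auto
    ultimately show ?thesis using s(2) l(3) by (simp add: mult.assoc)
  qed
  also have "\<dots> = m - l * m / 2" by (simp add: field_simps)
  also have "\<dots> < m" using l m by simp
  finally show False using mq[OF w] by simp
qed

text \<open>Separation from a weak-star closed convex set. Only finitely many coordinates matter at a
  time, so projecting in a finite-dimensional space replaces Hahn-Banach in the weak-star dual.\<close>

lemma in_weak_star_closed_convI:
  fixes a :: "'a::real_normed_vector dual"
  assumes supp: "\<And>h e. 0 < e \<Longrightarrow> \<exists>s\<in>S. blinfun_apply a h \<le> blinfun_apply s h + e"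
    and bdd: "\<And>h. \<exists>M. \<forall>s\<in>S. \<bar>blinfun_apply s h\<bar> \<le> M"
  shows "a \<in> weak_star_closed_conv S"
  unfolding weak_star_closed_conv_def
proof (rule in_weak_star_closureI)
  fix I :: "'a set" and e :: real assume I: "finite I" and e: "0 < e"
  have "\<exists>s\<in>convex hull S. (\<Sum>i\<in>I. (blinfun_apply a i - blinfun_apply s i)\<^sup>2) < e\<^sup>2"
  proof (rule convex_finite_approx[OF convex_convex_hull _ _ I])
    show "\<exists>s\<in>convex hull S. blinfun_apply a h \<le> blinfun_apply s h + e" if "0 < e" for h e
      using supp[OF that, of h] hull_subset[of S convex] by blast
    fix h
    obtain M where M: "\<forall>s\<in>S. \<bar>blinfun_apply s h\<bar> \<le> M" using bdd by blast
    \<comment> \<open>The slab of functionals bounded by \<open>M\<close> at \<open>h\<close> is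
      convex, so the bound passes from \<open>S\<close> to its hull.\<close>
    have "convex ((\<lambda>s. blinfun_apply s h) -` {- M..M})"
      by (rule convex_linear_vimage) (auto simp: linear_iff blinfun.add_left blinfun.scaleR_left)
    then have "convex hull S \<subseteq> (\<lambda>s. blinfun_apply s h) -` {- M..M}"
      using M by (intro hull_minimal) force
    then show "\<exists>M. \<forall>s\<in>convex hull S. \<bar>blinfun_apply s h\<bar> \<le> M"
      by (intro exI[of _ M]) (fastforce simp: abs_le_iff)
  qed (use e in simp)
  then obtain s where s: "s \<in> convex hull S" "(\<Sum>i\<in>I. (blinfun_apply a i - blinfun_apply s i)\<^sup>2) < e\<^sup>2" by blast
  have "\<bar>blinfun_apply s i - blinfun_apply a i\<bar> < e" if "i \<in> I" for i
  proof -
    have "(blinfun_apply a i - blinfun_apply s i)\<^sup>2 \<le> (\<Sum>i\<in>I. (blinfun_apply a i - blinfun_apply s i)\<^sup>2)"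
      using I that by (intro member_le_sum) auto
    then have "\<bar>blinfun_apply a i - blinfun_apply s i\<bar>\<^sup>2 < e\<^sup>2" using s by simp
    then show ?thesis using e by (simp add: abs_minus_commute power2_less_imp_less)
  qed
  then show "\<exists>s\<in>convex hull S. \<forall>i\<in>I. \<bar>blinfun_apply s i - blinfun_apply a i\<bar> < e" using s(1) by blast
qed

section \<open>Ekeland's variational principle\<close>

text \<open>The sets \<open>S x\<close> of points improving on \<open>x\<close> at rate
  \<open>\<gamma>\<close> are closed and transitive. Near-minimizers chosen successively in them
  give nested sets with diameters tending to zero; their common point \<open>z\<close> admits no
  improvement other than itself. The hypothesis \<open>cl\<close> supplies the lower semicontinuity
  in the form used.\<close>

lemma ekeland_point:
  fixes \<phi> :: "'a::complete_space \<Rightarrow> real"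
  assumes nonneg: "\<And>x. 0 \<le> \<phi> x" and g: "0 < \<gamma>"
    and cl: "\<And>x c. closed {y. \<phi> y + \<gamma> * dist x y \<le> c}"
  obtains z where "\<phi> z + \<gamma> * dist x z \<le> \<phi> x" "\<And>y. \<phi> z \<le> \<phi> y + \<gamma> * dist z y"
proof -
  define S where "S x = {y. \<phi> y + \<gamma> * dist x y \<le> \<phi> x}" for x
  have self: "x \<in> S x" for x by (simp add: S_def)
  have trans: "S y \<subseteq> S x" if "y \<in> S x" for x y
  proof
    fix z assume "z \<in> S y"
    moreover have "\<gamma> * dist x z \<le> \<gamma> * (dist x y + dist y z)"
      using g by (intro mult_left_mono dist_triangle) auto
    ultimately show "z \<in> S x" using that by (simp add: S_def distrib_left)
  qed
  have "\<exists>z. z \<in> S x \<and> (\<forall>y\<in>S x. \<phi> z \<le> \<phi> y + (1/2) ^ n)" for x n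
  proof -
    have bb: "bdd_below (\<phi> ` S x)" using nonneg by (intro bdd_belowI2)
    have "(INF y\<in>S x. \<phi> y) < (INF y\<in>S x. \<phi> y) + (1/2) ^ n" by simp
    then obtain z where z: "z \<in> S x" "\<phi> z < (INF y\<in>S x. \<phi> y) + (1/2) ^ n"
      using bb self[of x] by (subst (asm) cINF_less_iff) auto
    then show ?thesis using cINF_lower[OF bb] by (intro exI[of _ z]) force
  qed
  then obtain N where N: "\<And>x n. N x n \<in> S x" "\<And>x n y. y \<in> S x \<Longrightarrow> \<phi> (N x n) \<le> \<phi> y + (1/2) ^ n"
    by metis
  define u where "u = rec_nat x (\<lambda>n v. N v n)"
  have u: "u 0 = x" "\<And>n. u (Suc n) = N (u n) n" by (simp_all add: u_def)
  \<comment> \<open>Near-minimality at stage \<open>n\<close> leaves at most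
    \<open>(1/2) ^ n\<close> by which \<phi> can still decrease, and each improvement costs \<gamma>
    times the distance.\<close>
  have small: "\<gamma> * dist (u (Suc n)) y \<le> (1/2) ^ n" if "y \<in> S (u (Suc n))" for n y
  proof -
    have "y \<in> S (u n)" using that trans[OF N(1)] by (auto simp: u)
    then show ?thesis using N(2)[of y "u n" n] that by (simp add: S_def u)
  qed
  have dec: "S (u n) \<subseteq> S (u m)" if "m \<le> n" for m n
    using that trans[OF N(1)] by (induction rule: dec_induct) (auto simp: u)
  have pow: "\<exists>n. (1/2::real) ^ n < d" if "0 < d" for d
    using that by (intro real_arch_pow_inv) auto
  obtain z where z: "\<And>n. z \<in> S (u n)"
  proof (rule decreasing_closed_nest[of "\<lambda>n. S (u n)"])
    show "closed (S (u n))" for n using cl by (simp add: S_def)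
    show "S (u n) \<noteq> {}" for n using self by blast
    fix d :: real assume d: "0 < d"
    obtain n where n: "(1/2) ^ n < d * \<gamma> / 2" using pow[of "d * \<gamma> / 2"] d g by auto
    have "dist v w < d" if "v \<in> S (u (Suc n))" "w \<in> S (u (Suc n))" for v w
    proof -
      have "\<gamma> * dist v w \<le> \<gamma> * (dist (u (Suc n)) v + dist (u (Suc n)) w)"
        using g by (intro mult_left_mono) (auto intro: dist_triangle3)
      also have "\<dots> < \<gamma> * d" using small[OF that(1)] small[OF that(2)] n by (simp add: distrib_left mult.commute)
      finally show ?thesis using g by simp
    qed
    then show "\<exists>n. \<forall>v\<in>S (u n). \<forall>w\<in>S (u n). dist v w < d" by blast
  qed (use dec in auto)
  \<comment> \<open>\<open>S z\<close> lies in every \<open>S (u n)\<close>, so its diameter is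
    zero.\<close>
  have single: "y = z" if "y \<in> S z" for y
  proof (rule ccontr)
    assume "y \<noteq> z"
    then have "0 < dist z y * \<gamma> / 2" using g by simp
    then obtain n where n: "(1/2) ^ n < dist z y * \<gamma> / 2" using pow by blast
    have "\<gamma> * dist z y \<le> \<gamma> * (dist (u (Suc n)) z + dist (u (Suc n)) y)"
      using g by (intro mult_left_mono) (auto intro: dist_triangle3)
    also have "\<dots> < \<gamma> * dist z y"
      using small[OF z, of n] small[of y n] trans[OF z, of "Suc n"] that n
      by (auto simp: distrib_left mult.commute)
    finally show False by simp
  qed
  show thesis
  proof (rule that[of z])
    show "\<phi> z + \<gamma> * dist x z \<le> \<phi> x" using z[of 0] by (simp add: u S_def)
    show "\<phi> z \<le> \<phi> y + \<gamma> * dist z y" for y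
    proof (cases "y \<in> S z")
      case True then have "y = z" by (rule single)
      then show ?thesis by simp
    next
      case False then show ?thesis by (simp add: S_def)
    qed
  qed
qed

section \<open>Multipliers\<close>

lemma ext_dist_eq:
  assumes "S \<noteq> {}"
  shows "ext_dist x S = ereal (infdist x S)"
proof (rule antisym)
  show "ext_dist x S \<le> ereal (infdist x S)"
  proof (rule ereal_le_epsilon2)
    fix e :: real assume "0 < e"
    then obtain s where "s \<in> S" "dist x s < infdist x S + e" using infdist_approx[OF assms] by blast
    then show "ext_dist x S \<le> ereal (infdist x S) + ereal e"
      unfolding ext_dist_def by (intro INF_lower2[of s]) auto
  qed
  show "ereal (infdist x S) \<le> ext_dist x S"
    unfolding ext_dist_def by (intro INF_greatest) (simp add: infdist_le)
qed

text \<open>Inside \<open>K\<close> the distance vanishes, which gives normality at once. Outside,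
  the subgradient has norm one and decreases by at least the distance from \<open>x\<close> to every
  point of \<open>K\<close>; at a projection the decrease is exactly the distance, which gives
  normality there.\<close>

lemma infdist_subgradient_in_set_multipliers:
  fixes b :: "'a::real_normed_vector dual"
  assumes K: "closed K" "K \<noteq> {}"
    and sub: "\<And>w. blinfun_apply b (w - x) \<le> infdist w K - infdist x K"
  shows "b \<in> set_multipliers K x"
proof (cases "x \<in> K")
  case True
  have "blinfun_apply b (y - x) \<le> 0" if "y \<in> K" for y using sub[of y] that True by simp
  then have "b \<in> normal_cone x K" by (simp add: normal_cone_def)
  then show ?thesis using True infdist_subgradient_norm_le[OF sub] by (simp add: set_multipliers_def)
next
  case False
  have n: "norm b = 1"
    using infdist_subgradient_norm[OF K False sub] .
  have "b \<in> normal_cone w K" if w: "w \<in> K" "dist x w = infdist x K" for w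
    unfolding normal_cone_def
  proof (intro CollectI ballI)
    fix y assume "y \<in> K"
    then have "blinfun_apply b (y - x) \<le> - infdist x K" using sub[of y] by simp
    moreover have "- infdist x K \<le> blinfun_apply b (w - x)"
      using norm_blinfun[of b "w - x"] n w by (simp add: dist_norm norm_minus_commute abs_le_iff)
    ultimately show "blinfun_apply b (y - w) \<le> 0" by (simp add: blinfun.diff_right)
  qed
  then show ?thesis using False n K by (auto simp: set_multipliers_def metric_proj_def ext_dist_eq)
qed

section \<open>Distance to a convex cone and cone-concave maps\<close>

text \<open>A nearly closest point translated by \<open>c\<close> stays in the cone. This
  monotonicity in the cone order yields both the sign of subgradients and the convexity of the
  composed distance.\<close>

lemma infdist_convex_cone_add:
  fixes C :: "'a::real_normed_vector set"
  assumes C: "convex_cone C" and c: "c \<in> C"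
  shows "infdist (y + c) C \<le> infdist y C"
proof (rule field_le_epsilon)
  fix e :: real assume e: "0 < e"
  have "C \<noteq> {}" using c by blast
  then obtain s where s: "s \<in> C" "dist y s < infdist y C + e" using infdist_approx e by blast
  have "infdist (y + c) C \<le> dist (y + c) (s + c)"
    using convex_cone_add[OF C s(1) c] by (rule infdist_le)
  then show "infdist (y + c) C \<le> infdist y C + e" using s by simp
qed

lemma infdist_subgradient_in_neg_dual_cone:
  fixes v :: "'a::real_normed_vector dual"
  assumes C: "convex_cone C" and sub: "\<And>w. blinfun_apply v (w - y) \<le> infdist w C - infdist y C"
  shows "v \<in> neg_dual_cone C"
  unfolding neg_dual_cone_def
proof (intro CollectI ballI)
  fix c assume "c \<in> C"
  then show "blinfun_apply v c \<le> 0" using sub[of "y + c"] infdist_convex_cone_add[OF C, of c y] by simp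
qed

text \<open>Concavity puts the value at a convex combination above the combination of the values in
  the cone order, where the distance is no larger; the distance itself is convex.\<close>

lemma convex_on_infdist_cone_concave:
  fixes g :: "'a::real_vector \<Rightarrow> 'b::real_normed_vector"
  assumes C: "convex_cone C" and g: "cone_concave C g"
  shows "convex_on UNIV (\<lambda>x. infdist (g x) C)"
  unfolding convex_on_alt
proof (intro conjI ballI allI impI)
  fix x y and t :: real assume t: "0 \<le> t \<and> t \<le> 1"
  let ?m = "t *\<^sub>R g x + (1 - t) *\<^sub>R g y"
  have "g (t *\<^sub>R x + (1 - t) *\<^sub>R y) - ?m \<in> C" using g t by (simp add: cone_concave_def cone_le_def)
  from infdist_convex_cone_add[OF C this, of ?m]
  have "infdist (g (t *\<^sub>R x + (1 - t) *\<^sub>R y)) C \<le> infdist ?m C" by simp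
  also have "\<dots> \<le> t * infdist (g x) C + (1 - t) * infdist (g y) C"
    using convex_on_infdist[of C] C t by (simp add: convex_cone_def convex_on_alt)
  finally show "infdist (g (t *\<^sub>R x + (1 - t) *\<^sub>R y)) C \<le> t * infdist (g x) C + (1 - t) * infdist (g y) C" .
qed simp

text \<open>A functional in the negative dual cone reverses the cone order, so its composition with
  \<open>g\<close> is convex along the line through \<open>x\<close> and lies above its
  tangent.\<close>

lemma neg_dual_cone_derivative_le:
  fixes g :: "'a::real_normed_vector \<Rightarrow> 'b::real_normed_vector"
  assumes g: "cone_concave C g" "(g has_derivative L) (at x)" and v: "v \<in> neg_dual_cone C"
  shows "blinfun_apply v (L h) \<le> blinfun_apply v (g (x + h)) - blinfun_apply v (g x)"
proof -
  define \<psi> where "\<psi> t = blinfun_apply v (g (x + t *\<^sub>R h))" for t :: real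
  have "convex_on UNIV \<psi>"
    unfolding convex_on_alt
  proof (intro conjI ballI allI impI)
    fix s r t :: real assume t: "0 \<le> t \<and> t \<le> 1"
    have eq: "x + (t *\<^sub>R s + (1 - t) *\<^sub>R r) *\<^sub>R h = t *\<^sub>R (x + s *\<^sub>R h) + (1 - t) *\<^sub>R (x + r *\<^sub>R h)"
      by (simp add: algebra_simps)
    have "g (t *\<^sub>R (x + s *\<^sub>R h) + (1 - t) *\<^sub>R (x + r *\<^sub>R h))
        - (t *\<^sub>R g (x + s *\<^sub>R h) + (1 - t) *\<^sub>R g (x + r *\<^sub>R h)) \<in> C"
      using g(1) t by (simp add: cone_concave_def cone_le_def)
    then show "\<psi> (t *\<^sub>R s + (1 - t) *\<^sub>R r) \<le> t * \<psi> s + (1 - t) * \<psi> r"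
      using v unfolding neg_dual_cone_def \<psi>_def eq
      by (force simp: blinfun.diff_right blinfun.add_right blinfun.scaleR_right)
  qed simp
  moreover have "(\<psi> has_real_derivative blinfun_apply v (L h)) (at 0)"
  proof -
    have g': "(g has_derivative L) (at (x + 0 *\<^sub>R h))" using g(2) by simp
    have "((\<lambda>t::real. x + t *\<^sub>R h) has_derivative (\<lambda>t. t *\<^sub>R h)) (at 0)"
      by (auto intro!: derivative_eq_intros)
    from has_derivative_compose[OF this g']
    have "((\<lambda>t::real. g (x + t *\<^sub>R h)) has_derivative (\<lambda>t. L (t *\<^sub>R h))) (at 0)" .
    from bounded_linear.has_derivative[OF blinfun.bounded_linear_right this, of v]
    show ?thesis
      unfolding \<psi>_def has_field_derivative_def
      using linear_scale[OF has_derivative_linear[OF g(2)]]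
      by (simp add: blinfun.scaleR_right mult.commute[of _ "blinfun_apply v (L h)"] mult_commute_abs)
  qed
  ultimately have "blinfun_apply v (L h) * (1 - 0) \<le> \<psi> 1 - \<psi> 0"
    by (intro convex_on_imp_above_tangent[of UNIV]) auto
  then show ?thesis by (simp add: \<psi>_def)
qed

section \<open>Directional growth, multipliers and active indices\<close>

text \<open>The multiplier is a distance subgradient at the displaced value
  \<open>g (x + t *\<^sub>R h)\<close> for small \<open>t\<close>: its inequality towards
  \<open>g x\<close> bounds the growth from above by \<open>v\<close> of the increment, which is
  \<open>t *\<^sub>R L h\<close> up to a small error.\<close>

lemma directional_growth_multiplier:
  fixes g :: "'a::real_normed_vector \<Rightarrow> 'b::real_normed_vector"
  assumes C: "closed C" "convex_cone C" and g: "(g has_derivative L) (at x)"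
    and growth: "\<And>t. 0 < t \<Longrightarrow> t \<le> 1 \<Longrightarrow> a * t \<le> infdist (g (x + t *\<^sub>R h)) C - infdist (g x) C"
    and e: "0 < e"
  obtains v where "v \<in> neg_dual_cone C" "norm v \<le> 1" "g x \<notin> C \<Longrightarrow> norm v = 1"
    "a \<le> blinfun_apply v (L h) + e"
proof -
  have ne: "C \<noteq> {}" and cC: "convex C" using C(2) by (auto simp: convex_cone_def)
  \<comment> \<open>The \<open>+ 1\<close> keeps the quotient defined for \<open>h = 0\<close>, and
    \<open>e' * norm h \<le> e\<close> still holds.\<close>
  define e' where "e' = e / (norm h + 1)"
  have nh: "0 < norm h + 1" by (simp add: add_nonneg_pos)
  then have e': "0 < e'" using e by (simp add: e'_def)
  have "e' * (norm h + 1) = e" using nh by (simp add: e'_def)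
  then have e'h: "e' * norm h \<le> e" using e' by (simp add: distrib_left)
  obtain d1 where d1: "0 < d1" "\<And>y. norm (y - x) < d1 \<Longrightarrow> norm (g y - g x - L (y - x)) \<le> e' * norm (y - x)"
    using g e' unfolding has_derivative_at_alt by meson
  \<comment> \<open>Within this radius the displaced value stays off the closed cone whenever
    \<open>g x\<close> does, so the subgradient there has norm one.\<close>
  obtain d2 where d2: "0 < d2" "\<And>y. norm (y - x) < d2 \<Longrightarrow> g x \<notin> C \<Longrightarrow> g y \<notin> C"
  proof (cases "g x \<in> C")
    case True
    show thesis by (rule that[of 1]) (use True in auto)
  next
    case False
    have "(g \<longlongrightarrow> g x) (nhds x)"
      using has_derivative_continuous[OF g] by (simp add: isCont_def tendsto_at_iff_tendsto_nhds)
    then have "\<forall>\<^sub>F y in nhds x. g y \<in> - C"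
      by (rule topological_tendstoD) (use C(1) False in auto)
    then obtain d where "0 < d" "\<forall>y. dist y x < d \<longrightarrow> g y \<in> - C" by (auto simp only: eventually_nhds_metric)
    then show thesis by (intro that[of d]) (auto simp: dist_norm)
  qed
  define t where "t = min 1 (min d1 d2 / 2 / (norm h + 1))"
  have t: "0 < t" "t \<le> 1" using d1 d2 nh by (auto simp: t_def)
  have "t * (norm h + 1) \<le> min d1 d2 / 2 / (norm h + 1) * (norm h + 1)"
    using nh by (intro mult_right_mono) (auto simp: t_def)
  also have "\<dots> = min d1 d2 / 2" 
    by (subst times_divide_eq_left, subst nonzero_mult_div_cancel_right) (use nh in auto)
  finally have "t * norm h < min d1 d2" using d1(1) d2(1) t(1) by (simp add: distrib_left)
  then have near: "norm ((x + t *\<^sub>R h) - x) < d1" "norm ((x + t *\<^sub>R h) - x) < d2" using t by auto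
  let ?y = "g (x + t *\<^sub>R h)"
  obtain v :: "'b dual" where v: "norm v \<le> 1" "\<And>w. blinfun_apply v (w - ?y) \<le> infdist w C - infdist ?y C"
    using infdist_subgradient_exists[OF cC] by blast
  have Lt: "L (t *\<^sub>R h) = t *\<^sub>R L h" using has_derivative_linear[OF g] by (rule linear_scale)
  show thesis
  proof (rule that[of v])
    show "v \<in> neg_dual_cone C" using infdist_subgradient_in_neg_dual_cone[OF C(2) v(2)] .
    show "norm v \<le> 1" by fact
    show "norm v = 1" if "g x \<notin> C"
      using infdist_subgradient_norm[OF C(1) ne d2(2)[OF near(2) that] v(2)] .
    have "norm (?y - g x - t *\<^sub>R L h) \<le> e' * norm h * t"
      using d1(2)[OF near(1)] t Lt by (simp add: mult_ac)
    also have "\<dots> \<le> e * t" using e'h t by (intro mult_right_mono) auto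
    finally have r: "norm (?y - g x - t *\<^sub>R L h) \<le> e * t" .
    have "a * t \<le> blinfun_apply v (?y - g x)"
      using growth[OF t] v(2)[of "g x"] by (simp add: blinfun.diff_right)
    also have "\<dots> = t * blinfun_apply v (L h) + blinfun_apply v (?y - g x - t *\<^sub>R L h)"
      by (simp add: blinfun.diff_right blinfun.scaleR_right)
    also have "blinfun_apply v (?y - g x - t *\<^sub>R L h) \<le> e * t"
      using norm_blinfun[of v "?y - g x - t *\<^sub>R L h"] r mult_right_mono[OF v(1) norm_ge_zero, of "?y - g x - t *\<^sub>R L h"]
      by simp
    finally have "a * t \<le> (blinfun_apply v (L h) + e) * t" by (simp add: algebra_simps)
    then show "a \<le> blinfun_apply v (L h) + e" using t by simp
  qed
qed

text \<open>Indices maximal at times tending to zero cluster at some \<open>z\<close>, which is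
  maximal at time \<open>0\<close> by continuity. Convexity in \<open>t\<close> carries growth at a
  small time to every later time, and continuity carries it on to \<open>z\<close>.\<close>

lemma compact_active_growth:
  fixes G :: "real \<Rightarrow> 'z::metric_space \<Rightarrow> real"
  assumes K: "compact K" and cont: "continuous_on ({0..1} \<times> K) (\<lambda>(t, z). G t z)"
    and cvx: "\<And>z. z \<in> K \<Longrightarrow> convex_on {0..1} (\<lambda>t. G t z)"
    and ub: "\<And>t z. t \<in> {0..1} \<Longrightarrow> z \<in> K \<Longrightarrow> G t z \<le> N t"
    and att: "\<And>t. t \<in> {0..1} \<Longrightarrow> \<exists>z\<in>K. G t z = N t"
    and growth: "\<And>t. 0 < t \<Longrightarrow> t \<le> 1 \<Longrightarrow> a * t \<le> N t - N 0"
  obtains z where "z \<in> K" "G 0 z = N 0" "\<And>t. 0 < t \<Longrightarrow> t \<le> 1 \<Longrightarrow> a * t \<le> G t z - G 0 z"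
proof -
  define \<tau> where "\<tau> n = inverse (real (Suc n))" for n
  have \<tau>: "0 < \<tau> n" "\<tau> n \<le> 1" for n by (auto simp: \<tau>_def field_simps)
  have \<tau>0: "\<tau> \<longlonglongrightarrow> 0" unfolding \<tau>_def by (rule LIMSEQ_inverse_real_of_nat)
  have "\<forall>n. \<exists>z\<in>K. G (\<tau> n) z = N (\<tau> n)" using att \<tau> by (simp add: less_imp_le)
  then obtain \<zeta> where \<zeta>: "\<And>n. \<zeta> n \<in> K" "\<And>n. G (\<tau> n) (\<zeta> n) = N (\<tau> n)" by metis
  obtain z r where z: "z \<in> K" and r: "strict_mono r" "(\<zeta> \<circ> r) \<longlonglongrightarrow> z"
    using K \<zeta>(1) unfolding compact_def by blast
  have \<tau>r: "(\<lambda>n. \<tau> (r n)) \<longlonglongrightarrow> 0" using LIMSEQ_subseq_LIMSEQ[OF \<tau>0 r(1)] by (simp add: o_def)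
  have lim: "(\<lambda>n. G (\<sigma> n) (\<xi> n)) \<longlonglongrightarrow> G s w"
    if "\<sigma> \<longlonglongrightarrow> s" "\<xi> \<longlonglongrightarrow> w" "\<And>n. \<sigma> n \<in> {0..1}" "\<And>n. \<xi> n \<in> K" "s \<in> {0..1}" "w \<in> K" for \<sigma> \<xi> s w
    using continuous_on_tendsto_compose[OF cont tendsto_Pair[OF that(1,2)]] that(3-6) by auto
  have \<zeta>r: "(\<lambda>n. \<zeta> (r n)) \<longlonglongrightarrow> z" using r(2) by (simp add: o_def)
  show thesis
  proof (rule that[OF z])
    have "G 0 w \<le> G 0 z" if w: "w \<in> K" for w
    proof (rule LIMSEQ_le)
      show "(\<lambda>n. G (\<tau> (r n)) w) \<longlonglongrightarrow> G 0 w"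
        by (rule lim) (use \<tau>r \<tau> w in \<open>auto simp: less_imp_le\<close>)
      show "(\<lambda>n. G (\<tau> (r n)) (\<zeta> (r n))) \<longlonglongrightarrow> G 0 z"
        by (rule lim) (use \<tau>r \<zeta>r \<zeta>(1) \<tau> z in \<open>auto simp: less_imp_le\<close>)
      show "\<exists>m. \<forall>n\<ge>m. G (\<tau> (r n)) w \<le> G (\<tau> (r n)) (\<zeta> (r n))"
        using ub \<zeta>(2) \<tau> w by (simp add: less_imp_le)
    qed
    then show "G 0 z = N 0" using att[of 0] ub[of 0 z] z by force
    fix t :: real assume t: "0 < t" "t \<le> 1"
    \<comment> \<open>The chosen index attains \<open>N\<close> at \<open>\<tau> n\<close> and is at
      most \<open>N 0\<close> at time \<open>0\<close>, so it inherits the growth of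
      \<open>N\<close>; difference quotients from \<open>0\<close> increase with time.\<close>
    have "a * t \<le> G t (\<zeta> n) - G 0 (\<zeta> n)" if le: "\<tau> n \<le> t" for n
    proof -
      let ?u = "\<tau> n / t"
      have u: "0 < ?u" "?u \<le> 1" using \<tau>(1) t le by auto
      have "G ((1 - ?u) *\<^sub>R 0 + ?u *\<^sub>R t) (\<zeta> n) \<le> (1 - ?u) * G 0 (\<zeta> n) + ?u * G t (\<zeta> n)"
        by (rule convex_onD[OF cvx[OF \<zeta>(1)]]) (use u t in auto)
      then have "G (\<tau> n) (\<zeta> n) - G 0 (\<zeta> n) \<le> ?u * (G t (\<zeta> n) - G 0 (\<zeta> n))"
        using t by (simp add: algebra_simps)
      moreover have "a * \<tau> n \<le> G (\<tau> n) (\<zeta> n) - G 0 (\<zeta> n)"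
        using growth[OF \<tau>[of n]] \<zeta>(2)[of n] ub[of 0 "\<zeta> n"] \<zeta>(1) by simp
      ultimately have "?u * (a * t) \<le> ?u * (G t (\<zeta> n) - G 0 (\<zeta> n))" using t(1) by (simp add: mult.commute)
      then show ?thesis using u(1) by (rule mult_left_le_imp_le)
    qed
    moreover have "\<forall>\<^sub>F n in sequentially. \<tau> (r n) \<le> t"
      using order_tendstoD(2)[OF \<tau>r t(1)] by eventually_elim simp
    ultimately have "\<forall>\<^sub>F n in sequentially. a * t \<le> G t (\<zeta> (r n)) - G 0 (\<zeta> (r n))"
      by (auto elim: eventually_mono)
    moreover have "(\<lambda>n. G t (\<zeta> (r n)) - G 0 (\<zeta> (r n))) \<longlonglongrightarrow> G t z - G 0 z"
      by (intro tendsto_diff lim tendsto_const) (use \<zeta>r \<zeta>(1) z t in auto)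
    ultimately show "a * t \<le> G t z - G 0 z"
      by (intro tendsto_lowerbound[where F = sequentially]) auto
  qed
qed

section \<open>The merit function\<close>

text \<open>Real-valued form of \<open>merit\<close>, to which the real convexity and Hahn-Banach
  results apply; for compact nonempty \<open>K\<close> the supremum is attained and the two
  agree.\<close>

definition cone_gap :: "('a \<Rightarrow> 'a \<Rightarrow> 'b::metric_space) \<Rightarrow> 'a set \<Rightarrow> 'b set \<Rightarrow> 'a \<Rightarrow> real" where
  "cone_gap f K C x = (SUP z\<in>K. infdist (f x z) C)"

lemma continuous_on_second:
  fixes f :: "'a::topological_space \<Rightarrow> 'b::topological_space \<Rightarrow> 'c::topological_space"
  assumes "continuous_on UNIV (\<lambda>(x, z). f x z)"
  shows "continuous_on S (f x)"
  using continuous_on_compose2[OF assms, of S "\<lambda>z. (x, z)"] by (simp add: continuous_intros)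

lemma continuous_on_first:
  fixes f :: "'a::topological_space \<Rightarrow> 'b::topological_space \<Rightarrow> 'c::topological_space"
  assumes "continuous_on UNIV (\<lambda>(x, z). f x z)"
  shows "continuous_on S (\<lambda>x. f x z)"
  using continuous_on_compose2[OF assms, of S "\<lambda>x. (x, z)"] by (simp add: continuous_intros)

context
  fixes f :: "'a::real_normed_vector \<Rightarrow> 'a \<Rightarrow> 'b::real_normed_vector" and K :: "'a set" and C :: "'b set"
  assumes K: "compact K" "K \<noteq> {}" and C: "closed C" "convex_cone C"
    and f_cont: "continuous_on UNIV (\<lambda>(x, z). f x z)"
begin

private lemma C_ne: "C \<noteq> {}"
  using C by (simp add: convex_cone_def)

lemma cone_gap_attained: "\<exists>z\<in>K. infdist (f x z) C = cone_gap f K C x"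
  and cone_gap_upper: "z \<in> K \<Longrightarrow> infdist (f x z) C \<le> cone_gap f K C x"
proof -
  have "continuous_on K (\<lambda>z. infdist (f x z) C)"
    by (intro continuous_on_infdist continuous_on_second[OF f_cont])
  then obtain w where w: "w \<in> K" "\<And>z. z \<in> K \<Longrightarrow> infdist (f x z) C \<le> infdist (f x w) C"
    using continuous_attains_sup[OF K] by blast
  have "cone_gap f K C x = infdist (f x w) C"
    unfolding cone_gap_def by (rule cSup_eq_maximum) (use w in auto)
  then show "\<exists>z\<in>K. infdist (f x z) C = cone_gap f K C x"
    and "z \<in> K \<Longrightarrow> infdist (f x z) C \<le> cone_gap f K C x" using w by auto
qed

lemma cone_gap_le_iff: "cone_gap f K C x \<le> c \<longleftrightarrow> (\<forall>z\<in>K. infdist (f x z) C \<le> c)"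
  using cone_gap_attained[of x] cone_gap_upper[of _ x] by (metis order_trans)

lemma cone_gap_nonneg: "0 \<le> cone_gap f K C x"
  using cone_gap_attained[of x] infdist_nonneg by metis

lemma merit_eq_cone_gap: "merit f K C x = ereal (cone_gap f K C x)"
proof -
  obtain w where w: "w \<in> K" "infdist (f x w) C = cone_gap f K C x" using cone_gap_attained by blast
  show ?thesis
    unfolding merit_def ext_dist_eq[OF C_ne]
  proof (rule antisym)
    show "(SUP z\<in>K. ereal (infdist (f x z) C)) \<le> ereal (cone_gap f K C x)"
      by (rule SUP_least) (simp add: cone_gap_upper)
    show "ereal (cone_gap f K C x) \<le> (SUP z\<in>K. ereal (infdist (f x z) C))"
      by (rule SUP_upper2[OF w(1)]) (simp add: w)
  qed
qed

text \<open>The gap is a supremum of continuous functions, so the sublevel set is an intersection of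
  closed sets. This is the closedness needed for \<open>ekeland_point\<close>.\<close>

lemma closed_gap_sublevel:
  "closed {y. cone_gap f K C y + infdist y K + \<gamma> * dist x y \<le> c}"
proof -
  have "{y. cone_gap f K C y + infdist y K + \<gamma> * dist x y \<le> c}
      = {y. cone_gap f K C y \<le> c - (infdist y K + \<gamma> * dist x y)}" by auto
  also have "\<dots> = (\<Inter>z\<in>K. {y. infdist (f y z) C \<le> c - (infdist y K + \<gamma> * dist x y)})"
    by (auto simp: cone_gap_le_iff)
  also have "closed \<dots>"
    by (intro closed_INT ballI closed_Collect_le continuous_intros continuous_on_infdist
        continuous_on_first[OF f_cont])
  finally show ?thesis .
qed

lemma closed_strong_equilibria: "closed (strong_equilibria f K C)"
proof -
  have "strong_equilibria f K C = K \<inter> (\<Inter>z\<in>K. (\<lambda>x. f x z) -` C)"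
    by (auto simp: strong_equilibria_def)
  moreover have "closed ((\<lambda>x. f x z) -` C)" for z
    using continuous_on_first[OF f_cont, of UNIV z] C(1) by (simp add: closed_vimage)
  ultimately show ?thesis using compact_imp_closed[OF K(1)] by (metis (no_types, lifting) closed_INT closed_Int)
qed

section \<open>Convexity of the gap and its subgradients\<close>

context
  assumes f_concave: "\<And>z. z \<in> K \<Longrightarrow> cone_concave C (\<lambda>x. f x z)"
begin

lemma convex_on_cone_gap: "convex_on UNIV (cone_gap f K C)"
  unfolding convex_on_alt
proof (intro conjI ballI allI impI)
  fix x y and t :: real assume t: "0 \<le> t \<and> t \<le> 1"
  show "cone_gap f K C (t *\<^sub>R x + (1 - t) *\<^sub>R y) \<le> t * cone_gap f K C x + (1 - t) * cone_gap f K C y"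
    unfolding cone_gap_le_iff
  proof
    fix z assume z: "z \<in> K"
    have "infdist (f (t *\<^sub>R x + (1 - t) *\<^sub>R y) z) C \<le> t * infdist (f x z) C + (1 - t) * infdist (f y z) C"
      using convex_on_infdist_cone_concave[OF C(2) f_concave[OF z]] t by (simp add: convex_on_alt)
    also have "\<dots> \<le> t * cone_gap f K C x + (1 - t) * cone_gap f K C y"
      using t z by (intro add_mono mult_left_mono cone_gap_upper) auto
    finally show "infdist (f (t *\<^sub>R x + (1 - t) *\<^sub>R y) z) C \<le> t * cone_gap f K C x + (1 - t) * cone_gap f K C y" .
  qed
qed simp

text \<open>Membership is tested one direction \<open>h\<close> at a time: growth of the gap along
  \<open>h\<close> is inherited by a single active index, and then by a multiplier at that index up
  to \<open>e\<close>.\<close>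

lemma cone_gap_subgradient_in_conv:
  assumes f_deriv: "\<And>z. z \<in> K \<Longrightarrow> ((\<lambda>x. f x z) has_derivative blinfun_apply (D z)) (at x)"
    and sub: "\<And>h. blinfun_apply a h \<le> cone_gap f K C (x + h) - cone_gap f K C x"
  shows "a \<in> weak_star_closed_conv
    (\<Union>z\<in>active_set f K C x. adjoint_op (D z) ` cone_multipliers f K C x)"
proof (rule in_weak_star_closed_convI)
  fix h and e :: real assume e: "0 < e"
  let ?G = "\<lambda>t z. infdist (f (x + t *\<^sub>R h) z) C"
  obtain z where z: "z \<in> K" "?G 0 z = cone_gap f K C (x + 0 *\<^sub>R h)"
    "\<And>t. 0 < t \<Longrightarrow> t \<le> 1 \<Longrightarrow> blinfun_apply a h * t \<le> ?G t z - ?G 0 z"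
  proof (rule compact_active_growth[OF K(1), where G = ?G and N = "\<lambda>t. cone_gap f K C (x + t *\<^sub>R h)"
        and a = "blinfun_apply a h"])
    have "continuous_on ({0..1} \<times> K) (\<lambda>p. (\<lambda>(x, z). f x z) (x + fst p *\<^sub>R h, snd p))"
      by (rule continuous_on_compose2[OF f_cont]) (auto intro!: continuous_intros)
    then show "continuous_on ({0..1} \<times> K) (\<lambda>(t, z). ?G t z)"
      by (auto intro: continuous_on_infdist simp: case_prod_beta)
    fix z assume z: "z \<in> K"
    show "convex_on {0..1} (\<lambda>t. ?G t z)"
      unfolding convex_on_alt
    proof (intro conjI ballI allI impI)
      fix s r t :: real assume t: "0 \<le> t \<and> t \<le> 1"
      have "x + (t *\<^sub>R s + (1 - t) *\<^sub>R r) *\<^sub>R h = t *\<^sub>R (x + s *\<^sub>R h) + (1 - t) *\<^sub>R (x + r *\<^sub>R h)"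
        by (simp add: algebra_simps)
      then show "?G (t *\<^sub>R s + (1 - t) *\<^sub>R r) z \<le> t * ?G s z + (1 - t) * ?G r z"
        using convex_on_infdist_cone_concave[OF C(2) f_concave[OF z]] t by (simp only: convex_on_alt) blast
    qed simp
  next
    fix t :: real assume "0 < t" "t \<le> 1"
    show "blinfun_apply a h * t \<le> cone_gap f K C (x + t *\<^sub>R h) - cone_gap f K C (x + 0 *\<^sub>R h)"
      using sub[of "t *\<^sub>R h"] by (simp add: blinfun.scaleR_right mult.commute)
  qed (use cone_gap_attained cone_gap_upper in auto)
  have active: "z \<in> active_set f K C x"
    using z by (simp add: active_set_def ext_dist_eq[OF C_ne] merit_eq_cone_gap)
  obtain v where v: "v \<in> neg_dual_cone C" "norm v \<le> 1" "f x z \<notin> C \<Longrightarrow> norm v = 1"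
    "blinfun_apply a h \<le> blinfun_apply v (blinfun_apply (D z) h) + e"
    using directional_growth_multiplier[OF C f_deriv[OF z(1)] _ e, of "blinfun_apply a h" h] z(3) by auto
  \<comment> \<open>A positive gap puts the active value outside the cone, and \<open>v\<close> then
    lies on the sphere; for zero gap the ball suffices.\<close>
  have "f x z \<notin> C" if "merit f K C x \<noteq> 0"
    using that z(2) by (auto simp: merit_eq_cone_gap)
  then have "v \<in> cone_multipliers f K C x" using v by (simp add: cone_multipliers_def)
  then show "\<exists>s\<in>\<Union>z\<in>active_set f K C x. adjoint_op (D z) ` cone_multipliers f K C x.
      blinfun_apply a h \<le> blinfun_apply s h + e"
    using active v(4) by (intro bexI[of _ "adjoint_op (D z) v"]) (auto simp: adjoint_op_def)
next
  fix h
  have "continuous_on K (\<lambda>z. norm (f (x + k) z - f x z))" for k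
    by (intro continuous_intros continuous_on_second[OF f_cont])
  then have "\<exists>B. \<forall>z\<in>K. norm (f (x + k) z - f x z) \<le> B" for k
    using continuous_attains_sup[OF K] by blast
  \<comment> \<open>Compactness bounds the increments of \<open>f\<close> uniformly over
    \<open>K\<close>; by concavity they dominate the multipliers applied to the derivative. Using
    \<open>h\<close> and \<open>- h\<close> bounds the whole multiplier set at
    \<open>h\<close>.\<close>
  then obtain B where B: "\<And>k z. z \<in> K \<Longrightarrow> norm (f (x + k) z - f x z) \<le> B k" by metis
  have le: "blinfun_apply v (blinfun_apply (D z) k) \<le> B k"
    if z: "z \<in> K" and v: "v \<in> neg_dual_cone C" "norm v \<le> 1" for z v k
  proof -
    have "blinfun_apply v (blinfun_apply (D z) k) \<le> blinfun_apply v (f (x + k) z - f x z)"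
      using neg_dual_cone_derivative_le[OF f_concave[OF z] f_deriv[OF z] v(1), of k]
      by (simp add: blinfun.diff_right)
    also have "\<dots> \<le> norm (f (x + k) z - f x z)"
      using norm_blinfun[of v "f (x + k) z - f x z"]
        mult_right_mono[OF v(2) norm_ge_zero, of "f (x + k) z - f x z"] by simp
    finally show ?thesis using B[OF z, of k] by simp
  qed
  have "\<bar>blinfun_apply s h\<bar> \<le> max (B h) (B (- h))"
    if s: "s \<in> (\<Union>z\<in>active_set f K C x. adjoint_op (D z) ` cone_multipliers f K C x)" for s
  proof -
    obtain z v where act: "z \<in> active_set f K C x" and zv: "s = adjoint_op (D z) v" "v \<in> cone_multipliers f K C x"
      using s by blast
    have z: "z \<in> K" using act by (simp add: active_set_def)
    have "v \<in> neg_dual_cone C" "norm v \<le> 1"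
      using zv(2) by (auto simp: cone_multipliers_def split: if_splits)
    then show ?thesis using le[OF z, of v h] le[OF z, of v "- h"] zv(1)
      by (auto simp: adjoint_op_def blinfun.minus_right abs_le_iff le_max_iff_disj)
  qed
  then show "\<exists>M. \<forall>s\<in>\<Union>z\<in>active_set f K C x. adjoint_op (D z) ` cone_multipliers f K C x.
      \<bar>blinfun_apply s h\<bar> \<le> M" by blast
qed

text \<open>Minimality makes the sum of the increments of gap, distance and \<gamma> times the norm
  nonnegative. One sandwich splits off a linear part \<open>l\<close> for the gap, a second one a
  part \<open>m\<close> for the distance, and \<open>l + m\<close> stays below \<gamma> times the
  norm.\<close>

lemma small_subgradient_sum:
  assumes cK: "convex K" and f_deriv: "\<And>z. z \<in> K \<Longrightarrow> ((\<lambda>x. f x z) has_derivative blinfun_apply (D z)) (at x)"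
    and g: "0 \<le> \<gamma>"
    and min: "\<And>y. cone_gap f K C x + infdist x K \<le> cone_gap f K C y + infdist y K + \<gamma> * dist x y"
  shows "(weak_star_closed_conv (\<Union>z\<in>active_set f K C x. adjoint_op (D z) ` cone_multipliers f K C x)
    + set_multipliers K x) \<inter> cball 0 \<gamma> \<noteq> {}"
proof -
  let ?p = "\<lambda>h. cone_gap f K C (x + h) - cone_gap f K C x" and ?d = "\<lambda>h. infdist (x + h) K - infdist x K"
  have cp: "convex_on UNIV ?p" and cd: "convex_on UNIV ?d"
    by (rule convex_on_shift[OF convex_on_cone_gap], rule convex_on_shift[OF convex_on_infdist[OF cK]])
  have cn: "convex_on UNIV (\<lambda>h::'a. \<gamma> * norm h)"
    using g convex_on_dist[of UNIV "0::'a"] by (intro convex_on_cmul) auto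
  obtain l where l: "linear l" "\<And>h. l h \<le> ?p h" "\<And>h. - l h \<le> ?d h + \<gamma> * norm h"
  proof (rule convex_sandwich[OF cp _ convex_on_add[OF cd cn]])
    show "0 \<le> ?p h + (?d h + \<gamma> * norm h)" for h using min[of "x + h"] by (simp add: dist_norm)
  qed auto
  have cl: "convex_on UNIV l"
    using l(1) by (simp add: convex_on_def linear_add linear_scale)
  obtain m where m: "linear m" "\<And>h. m h \<le> ?d h" "\<And>h. - m h \<le> l h + \<gamma> * norm h"
  proof (rule convex_sandwich[OF cd _ convex_on_add[OF cl cn]])
    show "0 \<le> ?d h + (l h + \<gamma> * norm h)" for h using l(3)[of h] by simp
  qed (use linear_0[OF l(1)] in auto)
  have "m h \<le> 1 * norm h" for h using m(2)[of h] infdist_triangle[of "x + h" K x] by (simp add: dist_norm)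
  then obtain b :: "'a dual" where b: "blinfun_apply b = m"
    using linear_bounded_above_blinfun[OF m(1), of 1] by auto
  have "l h + m h \<le> \<gamma> * norm h" for h
    using m(3)[of "- h"] by (simp add: linear_neg[OF l(1)] linear_neg[OF m(1)])
  then obtain c :: "'a dual" where c: "blinfun_apply c = (\<lambda>h. l h + m h)" "norm c \<le> \<gamma>"
    using linear_bounded_above_blinfun[OF linear_compose_add[OF l(1) m(1)] g] by blast
  \<comment> \<open>\<open>l\<close> is obtained only as a linear map; as the difference of the
    bounded functionals \<open>c\<close> and \<open>b\<close> it becomes an element of the
    dual.\<close>
  have "c - b \<in> weak_star_closed_conv (\<Union>z\<in>active_set f K C x. adjoint_op (D z) ` cone_multipliers f K C x)"
    by (rule cone_gap_subgradient_in_conv[OF f_deriv]) (use l(2) b c in \<open>auto simp: blinfun.diff_left\<close>)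
  moreover have "b \<in> set_multipliers K x"
  proof (rule infdist_subgradient_in_set_multipliers)
    show "blinfun_apply b (w - x) \<le> infdist w K - infdist x K" for w using m(2)[of "w - x"] b by simp
  qed (use K compact_imp_closed in auto)
  ultimately have "(c - b) + b \<in> weak_star_closed_conv
      (\<Union>z\<in>active_set f K C x. adjoint_op (D z) ` cone_multipliers f K C x) + set_multipliers K x"
    by (rule set_plus_intro)
  then show ?thesis using c(2) by auto
qed

text \<open>By concavity the value at a convex combination is a convex combination of points of
  \<open>C\<close> plus an element of \<open>C\<close>.\<close>

lemma convex_strong_equilibria:
  assumes cK: "convex K"
  shows "convex (strong_equilibria f K C)"
  unfolding convex_alt
proof (intro ballI allI impI)
  fix x y and u :: real
  assume x: "x \<in> strong_equilibria f K C" and y: "y \<in> strong_equilibria f K C" and u: "0 \<le> u \<and> u \<le> 1"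
  let ?w = "(1 - u) *\<^sub>R x + u *\<^sub>R y"
  have "f ?w z \<in> C" if z: "z \<in> K" for z
  proof -
    let ?m = "(1 - u) *\<^sub>R f x z + (1 - (1 - u)) *\<^sub>R f y z"
    have "f ?w z - ?m \<in> C"
      using f_concave[OF z, unfolded cone_concave_def cone_le_def, rule_format, of "1 - u" x y] u by simp
    moreover have "?m \<in> C"
      using x y z u C(2) by (intro convex_cone_add convex_cone_scaleR) (auto simp: strong_equilibria_def)
    ultimately have "f ?w z - ?m + ?m \<in> C" by (rule convex_cone_add[OF C(2)])
    then show ?thesis by simp
  qed
  moreover have "?w \<in> K" using cK x y u by (simp add: strong_equilibria_def convex_alt)
  ultimately show "?w \<in> strong_equilibria f K C" by (simp add: strong_equilibria_def)
qed

end

end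

section \<open>Existence of strong equilibria and the error bound\<close>

theorem proposition3p13:
  fixes f :: "'a::banach \<Rightarrow> 'a \<Rightarrow> 'b::banach"
    and Df :: "'a \<Rightarrow> 'a \<Rightarrow> ('a \<Rightarrow>\<^sub>L 'b)"
    and K :: "'a set" and C :: "'b set" and \<gamma> :: real
  assumes X_reflexive: "reflexive TYPE('a)"
    and C_cone: "closed C" "convex_cone C" "C \<noteq> {0}" "C \<noteq> UNIV"
    and K_closed: "K \<noteq> {}" "closed K"
    and K_compact: "compact K" "convex K"
    and Y_reflexive: "reflexive TYPE('b)"
    and f_cont: "continuous_on UNIV (\<lambda>(x, z). f x z)"
    and f_concave: "\<And>z. z \<in> K \<Longrightarrow> cone_concave C (\<lambda>x. f x z)"
    and f_deriv: "\<And>z x. z \<in> K \<Longrightarrow> ((\<lambda>x. f x z) has_derivative blinfun_apply (Df z x)) (at x)"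
    and f_C1: "\<And>z. z \<in> K \<Longrightarrow> continuous_on UNIV (Df z)"
    and f_onto: "\<And>z x. z \<in> K \<Longrightarrow> surj (blinfun_apply (Df z x))"
    and gamma_pos: "\<gamma> > 0"
    and slope: "\<And>x. x \<notin> strong_equilibria f K C \<Longrightarrow>
       (weak_star_closed_conv
          (\<Union>z\<in>active_set f K C x. adjoint_op (Df z x) ` cone_multipliers f K C x)
        + set_multipliers K x) \<inter> cball 0 \<gamma> = {}"
  shows "strong_equilibria f K C \<noteq> {} \<and>
         closed (strong_equilibria f K C) \<and>
         convex (strong_equilibria f K C) \<and>
         (\<forall>x. ext_dist x (strong_equilibria f K C) \<le> merit_plus f K C x / ereal \<gamma>)"
proof -
  let ?SE = "strong_equilibria f K C"
  note setting = K_compact(1) K_closed(1) C_cone(1,2) f_cont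
  define \<phi> where "\<phi> x = cone_gap f K C x + infdist x K" for x
  have phi_nonneg: "0 \<le> \<phi> y" for y
    using cone_gap_nonneg[OF setting, of y] infdist_nonneg[of y K] by (simp add: \<phi>_def)
  have near: "\<exists>z\<in>?SE. \<gamma> * dist x z \<le> \<phi> x" for x
  proof -
    obtain z where z: "\<phi> z + \<gamma> * dist x z \<le> \<phi> x" "\<And>y. \<phi> z \<le> \<phi> y + \<gamma> * dist z y"
    proof (rule ekeland_point[of \<phi> \<gamma>])
      show "closed {y. \<phi> y + \<gamma> * dist w y \<le> c}" for w c
        unfolding \<phi>_def by (rule closed_gap_sublevel[OF setting])
    qed (use gamma_pos phi_nonneg in auto)
    have "z \<in> ?SE"
    proof (rule ccontr)
      assume "z \<notin> ?SE"
      from slope[OF this] show False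
        using small_subgradient_sum[OF setting f_concave K_compact(2) f_deriv less_imp_le[OF gamma_pos] z(2)[unfolded \<phi>_def]]
        by blast
    qed
    then show ?thesis using z(1) phi_nonneg[of z] by (intro bexI[of _ z]) auto
  qed
  \<comment> \<open>With nonemptiness the extended distance to the equilibrium set is the finite
    \<open>infdist\<close>.\<close>
  then have ne: "?SE \<noteq> {}" by blast
  have "ext_dist x ?SE \<le> merit_plus f K C x / ereal \<gamma>" for x
  proof -
    obtain z where z: "z \<in> ?SE" "\<gamma> * dist x z \<le> \<phi> x" using near by blast
    have "infdist x ?SE \<le> dist x z" using z(1) by (rule infdist_le)
    also have "\<dots> \<le> \<phi> x / \<gamma>" using z(2) gamma_pos by (simp add: field_simps)
    finally show ?thesis
      using gamma_pos by (simp add: ext_dist_eq[OF ne] ext_dist_eq[OF K_closed(1)] merit_plus_def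
          merit_eq_cone_gap[OF setting] \<phi>_def)
  qed
  then show ?thesis
    using ne closed_strong_equilibria[OF setting]
      convex_strong_equilibria[OF setting f_concave K_compact(2)] by blast
qed

end
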